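(* There is an algorithm which, given a connected bipartite cubic graph $G=(V,E)$ on $n$ vertices with $G\neq K_{3,3}$, together with machine speeds $s_1\geq s_2\geq s_3>0$, computes in $O(n^2)$ time an optimal schedule, i.e. a partition of $V$ into three independent sets $I_1,I_2,I_3$ minimizing $C_{\max}=\max\{|I_1|/s_1,\,|I_2|/s_2,\,|I_3|/s_3\}$.
   Context: Scheduling setting: $n$ identical unit-length jobs are the vertices of a cubic (3-regular) incompatibility graph $G$; two adjacent jobs may not be processed on the same machine. There are three uniform machines $M_1,M_2,M_3$ with speeds $s_1,s_2,s_3$; a job on $M_i$ takes $1/s_i$ time units. A schedule is a partition of $V(G)$ into independent sets $I_1,I_2,I_3$ (possibly empty), where $I_i$ is the load of $M_i$; its length is $C_{\max}=\max_i |I_i|/s_i$. An optimal schedule minimizes $C_{\max}$ over all such partitions. *)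

theory Defs
  imports Complex_Main "HOL-Library.Landau_Symbols" "Graph_Theory.Kuratowski"
begin

section \<open>Scheduling\<close>

text \<open>Graphs are the symmetric, loop-free digraphs without parallel arcs of
  \<^locale>\<open>graph\<close>, so the degree of a vertex is its out-degree.\<close>

definition cubic :: "('a, 'b) pre_digraph \<Rightarrow> bool" where
  "cubic G \<longleftrightarrow> (\<forall>v\<in>verts G. out_degree G v = 3)"

definition independent_set :: "('a, 'b) pre_digraph \<Rightarrow> 'a set \<Rightarrow> bool" where
  "independent_set G S \<longleftrightarrow> S \<subseteq> verts G \<and> (\<forall>u\<in>S. \<forall>v\<in>S. \<not> u \<rightarrow>\<^bsub>G\<^esub> v)"

definition bipartite :: "('a, 'b) pre_digraph \<Rightarrow> bool" where
  "bipartite G \<longleftrightarrow> (\<exists>U W. U \<union> W = verts G \<and> U \<inter> W = {} \<and>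
     independent_set G U \<and> independent_set G W)"

definition machines :: "nat set" where
  "machines = {1, 2, 3}"

definition schedule :: "('a, 'b) pre_digraph \<Rightarrow> (nat \<Rightarrow> 'a set) \<Rightarrow> bool" where
  "schedule G I \<longleftrightarrow> (\<Union>i\<in>machines. I i) = verts G \<and>
     (\<forall>i\<in>machines. \<forall>j\<in>machines. i \<noteq> j \<longrightarrow> I i \<inter> I j = {}) \<and>
     (\<forall>i\<in>machines. independent_set G (I i))"

definition Cmax :: "(nat \<Rightarrow> real) \<Rightarrow> (nat \<Rightarrow> 'a set) \<Rightarrow> real" where
  "Cmax s I = Max ((\<lambda>i. real (card (I i)) / s i) ` machines)"

definition optimal_schedule ::
    "('a, 'b) pre_digraph \<Rightarrow> (nat \<Rightarrow> real) \<Rightarrow> (nat \<Rightarrow> 'a set) \<Rightarrow> bool" where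
  "optimal_schedule G s I \<longleftrightarrow> schedule G I \<and>
     (\<forall>J. schedule G J \<longrightarrow> Cmax s I \<le> Cmax s J)"


section \<open>Algorithms and their running time\<close>

text \<open>
  Algorithms are programs of a structured random access machine under the uniform cost
  criterion. The memory consists of scalars and arrays of natural numbers and of
  scalars of real numbers, the latter as in the real RAM, since the speeds are arbitrary
  positive reals. The only arithmetic is addition and subtraction (truncated on the
  naturals), and there are neither real constants nor conversions between naturals and
  reals, so the speeds can only be inspected by comparing sums and differences of them.
  The same program can be run on an integer RAM when the speeds are integers.
\<close>

type_synonym vname = string

record state =
  nat_of :: "vname \<Rightarrow> nat"
  real_of :: "vname \<Rightarrow> real"
  arr_of :: "vname \<Rightarrow> nat \<Rightarrow> nat"

datatype nexp =
    Const nat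
  | Var vname
  | Elem vname nexp
  | Add nexp nexp
  | Sub nexp nexp

datatype rexp =
    RVar vname
  | RAdd rexp rexp
  | RSub rexp rexp

datatype bexp =
    NLess nexp nexp
  | RLess rexp rexp
  | Neg bexp
  | Conj bexp bexp

datatype com =
    Skip
  | Assign vname nexp
  | Store vname nexp nexp
  | RAssign vname rexp
  | Seq com com
  | Cond bexp com com
  | Loop bexp com

primrec nval :: "nexp \<Rightarrow> state \<Rightarrow> nat" where
  "nval (Const k) \<sigma> = k"
| "nval (Var x) \<sigma> = nat_of \<sigma> x"
| "nval (Elem a e) \<sigma> = arr_of \<sigma> a (nval e \<sigma>)"
| "nval (Add e f) \<sigma> = nval e \<sigma> + nval f \<sigma>"
| "nval (Sub e f) \<sigma> = nval e \<sigma> - nval f \<sigma>"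

primrec rval :: "rexp \<Rightarrow> state \<Rightarrow> real" where
  "rval (RVar x) \<sigma> = real_of \<sigma> x"
| "rval (RAdd e f) \<sigma> = rval e \<sigma> + rval f \<sigma>"
| "rval (RSub e f) \<sigma> = rval e \<sigma> - rval f \<sigma>"

primrec bval :: "bexp \<Rightarrow> state \<Rightarrow> bool" where
  "bval (NLess e f) \<sigma> \<longleftrightarrow> nval e \<sigma> < nval f \<sigma>"
| "bval (RLess e f) \<sigma> \<longleftrightarrow> rval e \<sigma> < rval f \<sigma>"
| "bval (Neg b) \<sigma> \<longleftrightarrow> \<not> bval b \<sigma>"
| "bval (Conj b c) \<sigma> \<longleftrightarrow> bval b \<sigma> \<and> bval c \<sigma>"

text \<open>
  \<open>exec c \<sigma> t \<sigma>'\<close>: started in \<open>\<sigma>\<close>, the program \<open>c\<close> halts in \<open>\<sigma>'\<close> after \<open>t\<close> steps.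
  Assignments and tests count as one step each. A program contains only finitely many
  expressions, so charging for every operator inside them would change the running
  time only by a constant factor depending on the program.
\<close>

inductive exec :: "com \<Rightarrow> state \<Rightarrow> nat \<Rightarrow> state \<Rightarrow> bool" where
  Skip: "exec Skip \<sigma> 1 \<sigma>"
| Assign: "exec (Assign x e) \<sigma> 1 (\<sigma>\<lparr>nat_of := (nat_of \<sigma>)(x := nval e \<sigma>)\<rparr>)"
| Store: "exec (Store a e f) \<sigma> 1
    (\<sigma>\<lparr>arr_of := (arr_of \<sigma>)(a := (arr_of \<sigma> a)(nval e \<sigma> := nval f \<sigma>))\<rparr>)"
| RAssign: "exec (RAssign x r) \<sigma> 1 (\<sigma>\<lparr>real_of := (real_of \<sigma>)(x := rval r \<sigma>)\<rparr>)"
| Seq: "exec c \<sigma> t \<sigma>' \<Longrightarrow> exec d \<sigma>' u \<sigma>'' \<Longrightarrow> exec (Seq c d) \<sigma> (t + u) \<sigma>''"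
| CondTrue: "bval b \<sigma> \<Longrightarrow> exec c \<sigma> t \<sigma>' \<Longrightarrow> exec (Cond b c d) \<sigma> (1 + t) \<sigma>'"
| CondFalse: "\<not> bval b \<sigma> \<Longrightarrow> exec d \<sigma> t \<sigma>' \<Longrightarrow> exec (Cond b c d) \<sigma> (1 + t) \<sigma>'"
| LoopFalse: "\<not> bval b \<sigma> \<Longrightarrow> exec (Loop b c) \<sigma> 1 \<sigma>"
| LoopTrue: "bval b \<sigma> \<Longrightarrow> exec c \<sigma> t \<sigma>' \<Longrightarrow> exec (Loop b c) \<sigma>' u \<sigma>'' \<Longrightarrow>
    exec (Loop b c) \<sigma> (1 + t + u) \<sigma>''"

inductive_cases exec_SkipE: "exec Skip \<sigma> t \<sigma>'"
inductive_cases exec_AssignE: "exec (Assign x e) \<sigma> t \<sigma>'"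
inductive_cases exec_StoreE: "exec (Store a e f) \<sigma> t \<sigma>'"
inductive_cases exec_RAssignE: "exec (RAssign x r) \<sigma> t \<sigma>'"
inductive_cases exec_SeqE: "exec (Seq c d) \<sigma> t \<sigma>'"
inductive_cases exec_CondE: "exec (Cond b c d) \<sigma> t \<sigma>'"
inductive_cases exec_LoopE: "exec (Loop b c) \<sigma> t \<sigma>'"

text \<open>Programs are deterministic, so final state and running time are determined by
  the initial state.\<close>

lemma exec_deterministic:
  "exec c \<sigma> t \<tau> \<Longrightarrow> exec c \<sigma> t' \<tau>' \<Longrightarrow> t' = t \<and> \<tau>' = \<tau>"
proof (induction arbitrary: t' \<tau>' rule: exec.induct)
  case (Seq c \<sigma> t \<sigma>' d u \<sigma>'')
  from Seq.prems obtain t1 t2 \<rho> where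
    "exec c \<sigma> t1 \<rho>" "exec d \<rho> t2 \<tau>'" "t' = t1 + t2"
    by (rule exec_SeqE)
  with Seq.IH show ?case by metis
next
  case (CondTrue b \<sigma> c t \<sigma>' d)
  from CondTrue.prems CondTrue.hyps obtain t1 where "exec c \<sigma> t1 \<tau>'" "t' = 1 + t1"
    by (cases rule: exec_CondE) auto
  with CondTrue.IH show ?case by simp
next
  case (CondFalse b \<sigma> d t \<sigma>' c)
  from CondFalse.prems CondFalse.hyps obtain t1 where "exec d \<sigma> t1 \<tau>'" "t' = 1 + t1"
    by (cases rule: exec_CondE) auto
  with CondFalse.IH show ?case by simp
next
  case (LoopFalse b \<sigma> c)
  from LoopFalse.prems LoopFalse.hyps show ?case
    by (cases rule: exec_LoopE) auto
next
  case (LoopTrue b \<sigma> c t \<sigma>' u \<sigma>'')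
  from LoopTrue.prems LoopTrue.hyps obtain t1 t2 \<rho> where
    "exec c \<sigma> t1 \<rho>" "exec (Loop b c) \<rho> t2 \<tau>'" "t' = 1 + t1 + t2"
    by (cases rule: exec_LoopE) auto
  with LoopTrue.IH show ?case by metis
next
  case Skip
  then show ?case by (auto elim!: exec_SkipE)
next
  case Assign
  then show ?case by (auto elim!: exec_AssignE)
next
  case Store
  then show ?case by (auto elim!: exec_StoreE)
next
  case RAssign
  then show ?case by (auto elim!: exec_RAssignE)
qed


section \<open>Input and output\<close>

text \<open>An adjacency-list representation lists the neighbours of each vertex in an
  arbitrary order.\<close>

definition adjacency_lists :: "('a, 'b) pre_digraph \<Rightarrow> ('a \<Rightarrow> 'a list) \<Rightarrow> bool" where
  "adjacency_lists G N \<longleftrightarrow>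
     (\<forall>v\<in>verts G. distinct (N v) \<and> set (N v) = {w. v \<rightarrow>\<^bsub>G\<^esub> w})"

text \<open>The input is a cubic graph on the vertices \<open>0, \<dots>, n - 1\<close>. Its adjacency lists,
  each of length three, are stored consecutively in one array; all memory that holds no
  input is zero.\<close>

definition input_state :: "nat \<Rightarrow> (nat \<Rightarrow> nat list) \<Rightarrow> (nat \<Rightarrow> real) \<Rightarrow> state" where
  "input_state n N s =
     \<lparr> nat_of = (\<lambda>_. 0)(''n'' := n),
       real_of = (\<lambda>_. 0)(''s1'' := s 1, ''s2'' := s 2, ''s3'' := s 3),
       arr_of = (\<lambda>_ _. 0)(''adj'' :=
         (\<lambda>k. if k < 3 * n then N (k div 3) ! (k mod 3) else 0)) \<rparr>"

text \<open>In the output, job \<open>v\<close> is assigned to the machine whose number is stored at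
  position \<open>v\<close> of the array \<open>machine\<close>.\<close>

definition output_loads :: "nat \<Rightarrow> state \<Rightarrow> nat \<Rightarrow> nat set" where
  "output_loads n \<sigma> i = {v. v < n \<and> arr_of \<sigma> ''machine'' v = i}"

end

theory Submission
  imports Defs
begin

text \<open>Let \<open>X\<close> and \<open>Y\<close> be the sides of the graph, each of size \<open>m = n / 2\<close>. No independent set has more
  than \<open>m\<close> vertices, and greedily adding the jobs one by one to the machine that finishes
  first, with at most \<open>m\<close> jobs per machine, yields sizes \<open>a \<ge> b \<ge> c\<close> that are optimal under this
  restriction. They are always realised: with \<open>k = m - a \<le> m / 3\<close>, choose \<open>S \<subseteq> X\<close> with \<open>k\<close> vertices and
  at most \<open>b\<close> neighbours, choose \<open>T\<close> with \<open>N(S) \<subseteq> T \<subseteq> Y\<close> and \<open>b\<close> vertices, and use the loads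
  \<open>X - S\<close>, \<open>T\<close> and \<open>S \<union> (Y - T)\<close>. By connectivity, growing \<open>S\<close> vertex by vertex reaches a set of size
  \<open>k\<close> with at most \<open>2 * k + 1\<close> neighbours, which suffices unless \<open>a = b = c = 2 * k\<close>. In that case one more
  neighbour has to be saved: grow from the neighbours of a single vertex to \<open>k + 1\<close> vertices,
  saving one neighbour in the last step by counting edges, and drop the vertex with the most
  private neighbours. This works for all \<open>k \<ge> 2\<close>, so the only exception is \<open>m = 3\<close>, the graph \<open>K\<^bsub>3,3\<^esub>\<close>.\<close>

section \<open>Neighbourhoods in bipartite cubic graphs\<close>

text \<open>The numbers behind the construction: \<open>a\<close> is the largest of three sizes with
  sum \<open>2 * m\<close>, hence \<open>3 * k \<le> m\<close>; \<open>b\<close> is the larger of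
  two sizes with sum \<open>m + k\<close>, hence \<open>m + k \<le> 2 * b\<close>. So
  \<open>b\<close> is at least \<open>2 * k\<close>, and at least \<open>2 * k + 1\<close> unless
  \<open>m = 3 * k\<close>. The third load has \<open>k + (m - b) = c\<close> vertices. Starting
  from one neighbourhood \<open>nb y\<close> supplies the bound \<open>7 = 2 * 3 + 1\<close> and
  also a vertex of \<open>Y\<close> with all three neighbours in \<open>S\<close>. That vertex
  contributes the surplus of one in the edge count which shows that some vertex of \<open>S\<close>
  has enough private neighbours to be dropped. For \<open>m = 3\<close> the sizes may be 2, 2, 2
  with \<open>k = 1\<close>, while a single vertex already has three neighbours. The running time is
  quadratic because every vertex stores its number of neighbours in \<open>S\<close>: a score takes
  constant time, a choice is one scan, and O(n) vertices are moved. The machine can neither multiply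
  nor divide, so completion times are compared through products that are updated by
  addition.\<close>

locale bicubic =
  fixes n :: nat and nb :: "nat \<Rightarrow> nat set" and X Y :: "nat set"
  assumes verts: "X \<union> Y = {0..<n}" and disjoint: "X \<inter> Y = {}"
    and nb_X: "x \<in> X \<Longrightarrow> nb x \<subseteq> Y" and nb_Y: "y \<in> Y \<Longrightarrow> nb y \<subseteq> X"
    and nb_sym: "u < n \<Longrightarrow> v \<in> nb u \<Longrightarrow> u \<in> nb v"
    and card_nb: "v < n \<Longrightarrow> card (nb v) = 3"
    and closed_eq: "S \<subseteq> {0..<n} \<Longrightarrow> S \<noteq> {} \<Longrightarrow> (\<And>v. v \<in> S \<Longrightarrow> nb v \<subseteq> S) \<Longrightarrow> S = {0..<n}"
    and zero_X: "0 \<in> X"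
begin

abbreviation "m \<equiv> card X"

definition nbs :: "nat set \<Rightarrow> nat set" where
  "nbs S = (\<Union>v\<in>S. nb v)"

lemma X_less: "x \<in> X \<Longrightarrow> x < n" and Y_less: "y \<in> Y \<Longrightarrow> y < n"
  using verts by auto

lemma finite_X [simp]: "finite X" and finite_Y [simp]: "finite Y"
  using finite_subset[of _ "{0..<n}"] verts by blast+

lemma finite_nb: "v < n \<Longrightarrow> finite (nb v)"
  using card_nb by (fastforce intro: card_ge_0_finite)

lemma nb_less: "v < n \<Longrightarrow> w \<in> nb v \<Longrightarrow> w < n"
  using nb_X[of v] nb_Y[of v] X_less[of w] Y_less[of w] verts by fastforce

lemma nb_sym_iff: "u < n \<Longrightarrow> v < n \<Longrightarrow> v \<in> nb u \<longleftrightarrow> u \<in> nb v"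
  using nb_sym by blast

text \<open>Both sides count the adjacent pairs in \<open>S\<close> times \<open>T\<close>; every
  edge count below is an instance.\<close>

lemma sum_card_nb_Int:
  assumes "S \<subseteq> {0..<n}" "T \<subseteq> {0..<n}"
  shows "(\<Sum>v\<in>S. card (nb v \<inter> T)) = (\<Sum>w\<in>T. card (nb w \<inter> S))"
proof -
  have fin: "finite S" "finite T" using assms finite_subset by auto
  have card_eq: "card (nb v \<inter> T) = (\<Sum>w\<in>T. of_bool (w \<in> nb v))" if "finite T" for v and T :: "nat set"
    using that by (simp add: Int_commute)
  have "(\<Sum>v\<in>S. card (nb v \<inter> T)) = (\<Sum>v\<in>S. \<Sum>w\<in>T. of_bool (w \<in> nb v))"
    using fin by (simp only: card_eq)
  also have "\<dots> = (\<Sum>w\<in>T. \<Sum>v\<in>S. of_bool (w \<in> nb v))" by (rule sum.swap)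
  also have "\<dots> = (\<Sum>w\<in>T. \<Sum>v\<in>S. of_bool (v \<in> nb w))"
    using assms nb_sym_iff by (intro sum.cong refl arg_cong[where f = of_bool]) (auto simp: subset_iff)
  also have "\<dots> = (\<Sum>w\<in>T. card (nb w \<inter> S))"
    using fin by (simp only: card_eq)
  finally show ?thesis .
qed

lemma nbs_subset_Y: "S \<subseteq> X \<Longrightarrow> nbs S \<subseteq> Y"
  using nb_X by (auto simp: nbs_def)

lemma finite_nbs: "S \<subseteq> X \<Longrightarrow> finite (nbs S)"
  using nbs_subset_Y finite_subset finite_Y by blast

lemma sum_degrees_nbs:
  assumes "S \<subseteq> X"
  shows "(\<Sum>y\<in>nbs S. card (nb y \<inter> S)) = 3 * card S"
proof -
  have "(\<Sum>y\<in>nbs S. card (nb y \<inter> S)) = (\<Sum>x\<in>S. card (nb x \<inter> nbs S))"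
    using assms nbs_subset_Y[OF assms] verts by (intro sum_card_nb_Int) auto
  also have "\<dots> = (\<Sum>x\<in>S. 3)"
  proof (intro sum.cong refl)
    fix x assume x: "x \<in> S"
    then have "nb x \<inter> nbs S = nb x" by (auto simp: nbs_def)
    then show "card (nb x \<inter> nbs S) = 3" using x assms card_nb X_less by auto
  qed
  finally show ?thesis by simp
qed

lemma card_Y: "card Y = m"
proof -
  have "(\<Sum>x\<in>X. card (nb x \<inter> Y)) = (\<Sum>y\<in>Y. card (nb y \<inter> X))"
    using verts by (intro sum_card_nb_Int) auto
  moreover have "(\<Sum>x\<in>X. card (nb x \<inter> Y)) = (\<Sum>x\<in>X. 3)"
    using nb_X card_nb X_less by (intro sum.cong refl) (auto simp: Int_absorb2)
  moreover have "(\<Sum>y\<in>Y. card (nb y \<inter> X)) = (\<Sum>y\<in>Y. 3)"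
    using nb_Y card_nb Y_less by (intro sum.cong refl) (auto simp: Int_absorb2)
  ultimately show ?thesis by simp
qed

lemma n_eq: "n = 2 * m"
  using card_Un_disjoint[OF finite_X finite_Y disjoint] card_Y verts by simp

text \<open>All three edges at a vertex of \<open>J\<close> leave \<open>J\<close>, and an outside
  vertex receives at most three, so \<open>J\<close> is no larger than its complement. This is the
  capacity that every competing schedule obeys as well.\<close>

lemma card_independent_le:
  assumes "J \<subseteq> {0..<n}" "\<And>u v. u \<in> J \<Longrightarrow> v \<in> J \<Longrightarrow> v \<notin> nb u"
  shows "card J \<le> m"
proof -
  have fin: "finite J" using assms(1) finite_subset by blast
  have "3 * card J = (\<Sum>v\<in>J. card (nb v \<inter> ({0..<n} - J)))"
  proof -
    have "nb v \<inter> ({0..<n} - J) = nb v" if "v \<in> J" for v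
      using that assms nb_less[of v] by (auto simp: subset_iff)
    then have "(\<Sum>v\<in>J. card (nb v \<inter> ({0..<n} - J))) = (\<Sum>v\<in>J. 3)"
      using assms card_nb by (intro sum.cong refl) (auto simp: subset_iff)
    then show ?thesis by simp
  qed
  also have "\<dots> = (\<Sum>w\<in>{0..<n} - J. card (nb w \<inter> J))"
    using assms by (intro sum_card_nb_Int) auto
  also have "\<dots> \<le> (\<Sum>w\<in>{0..<n} - J. 3)"
  proof (intro sum_mono)
    fix w assume "w \<in> {0..<n} - J"
    then show "card (nb w \<inter> J) \<le> 3"
      using card_nb[of w] card_mono[OF finite_nb, of w "nb w \<inter> J"] by auto
  qed
  also have "\<dots> = 3 * (n - card J)"
    using assms fin by (simp add: card_Diff_subset)
  finally show ?thesis using n_eq by linarith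
qed

lemma complete_if_card_X_3:
  assumes "card X = 3" "x \<in> X"
  shows "nb x = Y"
  using nb_X[OF assms(2)] card_nb[OF X_less[OF assms(2)]] card_Y assms(1)
  by (intro card_subset_eq) auto

end

section \<open>Subsets of one side with few neighbours\<close>

locale bicubic_not_K33 = bicubic +
  assumes card_X_neq: "card X \<noteq> 3"
begin

lemma m_ge_4: "4 \<le> m"
proof -
  have "nb 0 \<subseteq> Y" "0 < n" using nb_X zero_X X_less by auto
  then have "3 \<le> m" using card_nb[of 0] card_mono[OF finite_Y, of "nb 0"] card_Y by simp
  then show ?thesis using card_X_neq by linarith
qed

text \<open>The number of neighbours that occur, respectively would occur, in the neighbourhood of
  \<open>S\<close> only through \<open>v\<close>.\<close>

definition score :: "nat set \<Rightarrow> nat \<Rightarrow> nat" where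
  "score S v = card (nb v - nbs (S - {v}))"

lemma score_le: "v < n \<Longrightarrow> score S v \<le> 3"
  unfolding score_def using card_nb[of v] card_mono[OF finite_nb, of v "nb v - nbs (S - {v})"] by auto

lemma card_nbs_split:
  assumes "S \<subseteq> X" "v \<in> S"
  shows "card (nbs S) = card (nbs (S - {v})) + score S v"
proof -
  have "nbs S = nbs (S - {v}) \<union> (nb v - nbs (S - {v}))"
    using assms by (auto simp: nbs_def)
  moreover have "finite (nbs (S - {v}))" "finite (nb v)"
    using assms finite_nbs[of "S - {v}"] finite_nb X_less by auto
  ultimately show ?thesis
    unfolding score_def using card_Un_disjoint[of "nbs (S - {v})" "nb v - nbs (S - {v})"] by auto
qed

lemma score_insert: "score (insert v S) v = score S v"
  unfolding score_def by simp

lemma card_nbs_insert: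
  assumes "S \<subseteq> X" "v \<in> X" "v \<notin> S"
  shows "card (nbs (insert v S)) = card (nbs S) + score S v"
  using card_nbs_split[of "insert v S" v] assms by (simp add: score_insert)

lemma score_eq: "v < n \<Longrightarrow> v \<notin> S \<Longrightarrow> score S v + card (nb v \<inter> nbs S) = 3"
  unfolding score_def using card_nb finite_nb
  using card_Int_Diff[of "nb v" "nbs S"] by simp

text \<open>If every outside vertex had score 3, no edge would join \<open>nbs S\<close> to
  \<open>X - S\<close>. Then \<open>S \<union> nbs S\<close> would be closed under neighbours, hence
  by connectivity the whole graph.\<close>

lemma ex_score_le_2:
  assumes "S \<subset> X" "S \<noteq> {}"
  shows "\<exists>x\<in>X - S. score S x \<le> 2"
proof (rule ccontr)
  assume neg: "\<not> ?thesis"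
  then have *: "nb x \<inter> nbs S = {}" if x: "x \<in> X - S" for x
  proof -
    have "score S x + card (nb x \<inter> nbs S) = 3" "finite (nb x)"
      using score_eq[of x S] finite_nb[of x] x X_less[of x] by auto
    moreover have "\<not> score S x \<le> 2" using neg x by blast
    ultimately have "card (nb x \<inter> nbs S) = 0" by linarith
    then show ?thesis using \<open>finite (nb x)\<close> by simp
  qed
  have sub: "S \<union> nbs S \<subseteq> {0..<n}" using assms nbs_subset_Y[of S] verts by auto
  moreover have "nb v \<subseteq> S \<union> nbs S" if "v \<in> S \<union> nbs S" for v
  proof (cases "v \<in> S")
    case True
    then show ?thesis by (auto simp: nbs_def)
  next
    case False
    then have v: "v \<in> nbs S" "v < n" using that sub by auto
    show ?thesis
    proof
      fix w assume w: "w \<in> nb v"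
      have "w \<in> X" using w v nbs_subset_Y[of S] assms nb_Y by auto
      moreover have "v \<in> nb w" using w v nb_sym by auto
      ultimately show "w \<in> S \<union> nbs S" using * v by auto
    qed
  qed
  ultimately have "S \<union> nbs S = {0..<n}" using assms by (intro closed_eq) auto
  then show False using assms nbs_subset_Y[of S] verts disjoint by auto
qed

text \<open>With \<open>k = card S\<close>, the \<open>2 * k + 1\<close> neighbours carry
  \<open>6 * k + 3\<close> edges. If all outside scores were at least 2, each outside vertex would
  meet \<open>nbs S\<close> at most once, leaving at most \<open>(m - k) + 3 * k = 5 * k\<close>
  edges.\<close>

lemma ex_score_le_1:
  assumes "S \<subseteq> X" "card (nbs S) = 2 * card S + 1" "m = 3 * card S"
  shows "\<exists>x\<in>X - S. score S x \<le> 1"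
proof (rule ccontr)
  assume neg: "\<not> ?thesis"
  have fin: "finite S" using finite_subset[OF assms(1) finite_X] .
  have "3 * card (nbs S) = (\<Sum>y\<in>nbs S. card (nb y \<inter> X))"
  proof -
    have "card (nb y \<inter> X) = 3" if "y \<in> nbs S" for y
      using that nbs_subset_Y[of S] assms nb_Y[of y] card_nb Y_less[of y] by (auto simp: Int_absorb2)
    then show ?thesis by simp
  qed
  also have "\<dots> = (\<Sum>x\<in>X. card (nb x \<inter> nbs S))"
    using assms nbs_subset_Y[of S] verts by (intro sum_card_nb_Int) auto
  also have "\<dots> = (\<Sum>x\<in>X - S. card (nb x \<inter> nbs S)) + (\<Sum>x\<in>S. card (nb x \<inter> nbs S))"
    using assms by (intro sum.subset_diff) auto
  also have "\<dots> \<le> (\<Sum>x\<in>X - S. 1) + (\<Sum>x\<in>S. 3)"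
  proof (intro add_mono sum_mono)
    fix x assume x: "x \<in> X - S"
    then show "card (nb x \<inter> nbs S) \<le> 1" using neg score_eq[of x S] X_less[of x] by force
  next
    fix x assume "x \<in> S"
    then show "card (nb x \<inter> nbs S) \<le> 3"
      using assms(1) X_less[of x] card_nb[of x] card_mono[OF finite_nb, of x "nb x \<inter> nbs S"] by auto
  qed
  also have "\<dots> = (m - card S) + 3 * card S"
    using fin assms by (simp add: card_Diff_subset)
  finally show False using assms by linarith
qed

text \<open>Switches to the viewpoint of \<open>Y\<close>: a private neighbour of \<open>v\<close>
  is one that meets \<open>S\<close> in \<open>v\<close> alone. In this form scores can be summed by
  exchanging the order of counting.\<close>

lemma score_in:
  assumes "S \<subseteq> X" "v \<in> S"
  shows "score S v = card {y \<in> nb v. nb y \<inter> S = {v}}"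
proof -
  have "nb v - nbs (S - {v}) = {y \<in> nb v. nb y \<inter> S = {v}}"
  proof -
    have sym: "y \<in> nb u \<longleftrightarrow> u \<in> nb y" if "u \<in> S" "y \<in> nb v" for u y
      using nb_sym_iff[of u y] nb_less[of v y] X_less that assms by blast
    have "nb y \<inter> S = {v} \<longleftrightarrow> (\<forall>u\<in>S - {v}. y \<notin> nb u)" if "y \<in> nb v" for y
      using sym[OF _ that] that assms(2) by blast
    then show ?thesis by (auto simp: nbs_def)
  qed
  then show ?thesis by (simp add: score_def)
qed

text \<open>Count the edges at \<open>S\<close> from the side of the neighbours: all of them but the private ones,
  which the scores count, have at least two neighbours in \<open>S\<close>, and \<open>y\<close> has three.\<close>

lemma sum_score_ge:
  assumes S: "S \<subseteq> X" and y: "y \<in> Y" "nb y \<subseteq> S"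
  shows "2 * card (nbs S) + 1 \<le> 3 * card S + (\<Sum>v\<in>S. score S v)"
proof -
  let ?p = "\<lambda>y. of_bool (card (nb y \<inter> S) = 1) :: nat"
  have fin: "finite S" using finite_subset[OF S finite_X] .
  have finN: "finite (nbs S)" using S finite_nbs by simp
  have yN: "y \<in> nbs S"
  proof -
    obtain v where "v \<in> nb y" using card_nb[of y] y Y_less by fastforce
    then show ?thesis using y nb_sym[of y v] Y_less by (auto simp: nbs_def)
  qed
  have "(\<Sum>v\<in>S. score S v) = (\<Sum>v\<in>S. \<Sum>y\<in>nbs S. of_bool (nb y \<inter> S = {v}))"
  proof (intro sum.cong refl)
    fix v assume v: "v \<in> S"
    have "{y \<in> nb v. nb y \<inter> S = {v}} = {y \<in> nbs S. nb y \<inter> S = {v}}"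
    proof (intro set_eqI iffI)
      fix y assume "y \<in> {y \<in> nb v. nb y \<inter> S = {v}}"
      then show "y \<in> {y \<in> nbs S. nb y \<inter> S = {v}}" using v by (auto simp: nbs_def)
    next
      fix y assume a: "y \<in> {y \<in> nbs S. nb y \<inter> S = {v}}"
      then have "y < n" using nbs_subset_Y[OF S] Y_less by auto
      then show "y \<in> {y \<in> nb v. nb y \<inter> S = {v}}" using a nb_sym[of y v] by auto
    qed
    then show "score S v = (\<Sum>y\<in>nbs S. of_bool (nb y \<inter> S = {v}))"
      using score_in[OF S v] finN by (simp add: Int_def)
  qed
  also have "\<dots> = (\<Sum>y\<in>nbs S. \<Sum>v\<in>S. of_bool (nb y \<inter> S = {v}))" by (rule sum.swap)
  also have "\<dots> = (\<Sum>y\<in>nbs S. ?p y)"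
  proof (intro sum.cong refl)
    fix y
    have "(\<Sum>v\<in>S. of_bool (nb y \<inter> S = {v})) = card {v \<in> S. nb y \<inter> S = {v}}"
      using fin by (simp add: Int_def)
    also have "\<dots> = ?p y"
    proof (cases "card (nb y \<inter> S) = 1")
      case True
      then obtain v where v: "nb y \<inter> S = {v}" by (auto simp: card_1_singleton_iff)
      then have "{v \<in> S. nb y \<inter> S = {v}} = {v}" by auto
      then show ?thesis using True by simp
    next
      case False
      then have "{v \<in> S. nb y \<inter> S = {v}} = {}" by auto
      then have "card {v \<in> S. nb y \<inter> S = {v}} = 0" by (simp only: card.empty)
      then show ?thesis using False by simp
    qed
    finally show "(\<Sum>v\<in>S. of_bool (nb y \<inter> S = {v})) = ?p y" .
  qed
  finally have p: "(\<Sum>v\<in>S. score S v) = (\<Sum>y\<in>nbs S. ?p y)" .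
  have pos: "2 \<le> card (nb z \<inter> S) + ?p z" if z: "z \<in> nbs S" for z
  proof -
    obtain v where "v \<in> S" "z \<in> nb v" using z by (auto simp: nbs_def)
    then have "v \<in> nb z \<inter> S" using S X_less nb_sym by auto
    then have "card (nb z \<inter> S) \<noteq> 0" using fin by auto
    then show ?thesis by auto
  qed
  \<comment> \<open>The vertex \<open>y\<close> is split off: it contributes three instead of two,
    which is the \<open>+ 1\<close> of the claim.\<close>
  have "2 * card (nbs S) + 1 = 3 + (\<Sum>z\<in>nbs S - {y}. 2)"
    using yN finN by (cases "card (nbs S)") (auto simp: card_Diff_singleton)
  also have "\<dots> \<le> (card (nb y \<inter> S) + ?p y) + (\<Sum>z\<in>nbs S - {y}. card (nb z \<inter> S) + ?p z)"
    using pos y card_nb Y_less by (intro add_mono sum_mono) (auto simp: Int_absorb2)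
  also have "\<dots> = (\<Sum>z\<in>nbs S. card (nb z \<inter> S) + ?p z)"
    using yN finN by (simp add: sum.remove)
  also have "\<dots> = 3 * card S + (\<Sum>v\<in>S. score S v)"
    by (simp add: sum.distrib sum_degrees_nbs[OF S] p)
  finally show ?thesis .
qed

text \<open>The invariant of the growing phase, whose target is \<open>k + 1\<close> vertices: since \<open>m = 3 * k\<close> leaves no
  slack, one neighbour has to be saved then.\<close>

definition grown :: "nat \<Rightarrow> nat set \<Rightarrow> bool" where
  "grown k S \<longleftrightarrow> S \<subseteq> X \<and> (\<exists>y\<in>Y. nb y \<subseteq> S) \<and> card (nbs S) \<le> 2 * card S + 1 \<and>
     (m = 3 * k \<and> card S = k + 1 \<longrightarrow> card (nbs S) \<le> 2 * card S)"

lemma card_grown: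
  assumes "grown k S"
  shows "3 \<le> card S"
proof -
  obtain y where "y \<in> Y" "nb y \<subseteq> S" "finite S"
    using assms finite_subset[OF _ finite_X] unfolding grown_def by blast
  then show ?thesis using card_nb[of y] Y_less[of y] card_mono[of S "nb y"] by simp
qed

text \<open>The seed of the growth: besides \<open>y\<close> itself, each of the three vertices adds
  at most two neighbours, so there are at most \<open>1 + 3 * 2 = 2 * 3 + 1\<close>.\<close>

lemma grown_nb:
  assumes "y \<in> Y"
  shows "grown k (nb y)"
proof -
  have X: "nb y \<subseteq> X" and c: "card (nb y) = 3" using assms nb_Y card_nb Y_less by auto
  have "nb y \<noteq> {}" using c by auto
  then obtain a where a: "a \<in> nb y" by auto
  have "card (nb y - {a}) = 2" using a c finite_subset[OF X] by simp
  then obtain b d where bd: "nb y - {a} = {b, d}" "b \<noteq> d" by (auto simp: card_2_iff)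
  have abd: "nb y = {a, b, d}" using a bd by auto
  have less: "a < n" "b < n" "d < n" using abd X X_less by auto
  have yin: "y \<in> nb a" "y \<in> nb b" "y \<in> nb d" using abd assms Y_less nb_sym by auto
  have "nbs (nb y) \<subseteq> insert y ((nb a - {y}) \<union> (nb b - {y}) \<union> (nb d - {y}))"
    by (auto simp: nbs_def abd)
  moreover have "card \<dots> \<le> Suc (card ((nb a - {y}) \<union> (nb b - {y}) \<union> (nb d - {y})))"
    by (rule card_insert_le_m1) simp_all
  moreover have "card ((nb a - {y}) \<union> (nb b - {y}) \<union> (nb d - {y})) \<le> 2 + 2 + 2"
    using less yin card_nb finite_nb
    by (intro order.trans[OF card_Un_le] add_mono) (auto simp: card_Diff_singleton)
  ultimately have "card (nbs (nb y)) \<le> 7"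
    using card_mono[of "insert y ((nb a - {y}) \<union> (nb b - {y}) \<union> (nb d - {y}))" "nbs (nb y)"]
      less finite_nb by auto
  \<comment> \<open>For \<open>k = 2\<close> and \<open>m = 6\<close> the seed already has
    \<open>k + 1\<close> vertices; the sharper bound \<open>2 * 3\<close> then holds because
    \<open>Y\<close> has only six vertices.\<close>
  moreover have "card (nbs (nb y)) \<le> m"
    using card_mono[OF finite_Y nbs_subset_Y[OF X]] card_Y by simp
  ultimately show ?thesis unfolding grown_def using X assms c by auto
qed

lemma grown_insert:
  assumes g: "grown k S" and "card S \<le> k" "3 * k \<le> m"
    and x: "x \<in> X" "x \<notin> S" and min: "\<And>v. v \<in> X \<Longrightarrow> v \<notin> S \<Longrightarrow> score S x \<le> score S v"
  shows "grown k (insert x S)"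
proof -
  have S: "S \<subseteq> X" and N: "card (nbs S) \<le> 2 * card S + 1" using g by (auto simp: grown_def)
  have fin: "finite S" using finite_subset[OF S finite_X] .
  have "S \<noteq> {}" using card_grown[OF g] by auto
  then have le2: "score S x \<le> 2" using ex_score_le_2[of S] S x min by fastforce
  have c: "card (insert x S) = card S + 1" using fin x by simp
  have N': "card (nbs (insert x S)) = card (nbs S) + score S x"
    using card_nbs_insert[OF S] x by simp
  \<comment> \<open>The last growing step in the tight case: either a neighbour was saved earlier,
    or the edge count provides a vertex of score at most 1.\<close>
  have "card (nbs S) + score S x \<le> 2 * card S + 2" if "m = 3 * k" "card S = k"
  proof (cases "card (nbs S) = 2 * card S + 1")
    case True
    then have "score S x \<le> 1" using ex_score_le_1[OF S] that min by fastforce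
    then show ?thesis using True by simp
  next
    case False
    then show ?thesis using N le2 by simp
  qed
  then show ?thesis using g N N' le2 c x unfolding grown_def by auto
qed

text \<open>Dropping \<open>v\<close> loses \<open>score S v\<close> neighbours, so at most
  \<open>2 * k\<close> remain, or \<open>2 * k + 1\<close> if \<open>m \<noteq> 3 * k\<close>; that
  many fit into \<open>b\<close>. If all scores were smaller, their sum would violate
  \<open>sum_score_ge\<close>.\<close>

lemma ex_score_ge:
  assumes g: "grown k S" and "card S = k + 1" "2 \<le> k"
  shows "\<exists>v\<in>S. card (nbs S) \<le> score S v + 2 * k + of_bool (m \<noteq> 3 * k)"
proof (rule ccontr)
  define e :: nat where "e = of_bool (m \<noteq> 3 * k)"
  assume "\<not> ?thesis"
  then have neg: "\<not> card (nbs S) \<le> score S v + 2 * k + e" if "v \<in> S" for v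
    using that unfolding e_def by blast
  obtain y where y: "y \<in> Y" "nb y \<subseteq> S" and S: "S \<subseteq> X" using g by (auto simp: grown_def)
  have N: "card (nbs S) \<le> 2 * k + 2 + e"
    using g assms by (auto simp: grown_def e_def)
  \<comment> \<open>\<open>?d\<close> is the score that would suffice, and the invariant makes it at
    most 2. With all scores below \<open>?d\<close>, their sum is at most \<open>k + 1\<close> if
    \<open>?d = 2\<close>, and 0 if \<open>?d = 1\<close>.\<close>
  let ?d = "card (nbs S) - 2 * k - e"
  have pos: "score S v + 1 \<le> ?d" if "v \<in> S" for v using neg[OF that] by linarith
  have "S \<noteq> {}" using assms by auto
  then have "1 \<le> ?d" using pos by fastforce
  have "?d \<le> 2" using N by linarith
  have le: "(\<Sum>v\<in>S. score S v) \<le> (\<Sum>v\<in>S. ?d - 1)" using pos by (intro sum_mono) fastforce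
  have "(\<Sum>v\<in>S. ?d - 1) \<le> (\<Sum>v\<in>S. 1)" using \<open>?d \<le> 2\<close> by (intro sum_mono) linarith
  with le have "(\<Sum>v\<in>S. score S v) \<le> k + 1" "?d \<noteq> 1 \<or> (\<Sum>v\<in>S. score S v) = 0"
    using assms(2) by auto
  moreover have "2 * card (nbs S) + 1 \<le> 3 * (k + 1) + (\<Sum>v\<in>S. score S v)"
    using sum_score_ge[OF S y] assms by simp
  moreover have "card (nbs S) = 2 * k + e + 1 \<and> ?d = 1 \<or> card (nbs S) = 2 * k + e + 2"
    using \<open>1 \<le> ?d\<close> \<open>?d \<le> 2\<close> by linarith
  \<comment> \<open>For \<open>?d = 2\<close> the edge count reads
    \<open>4 * k + 2 * e + 5 \<le> 4 * k + 4\<close>, so the surplus of one is decisive; for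
    \<open>?d = 1\<close> it reads \<open>4 * k + 2 * e + 3 \<le> 3 * k + 3\<close>.\<close>
  ultimately show False using assms(3) by auto
qed

lemma grown_remove:
  assumes g: "grown k S" and "card S = k + 1" "2 \<le> k" "3 * k \<le> m" "m + k \<le> 2 * b"
    and u: "u \<in> S" and max: "\<And>v. v \<in> S \<Longrightarrow> score S v \<le> score S u"
  shows "card (nbs (S - {u})) \<le> b"
proof -
  obtain v where v: "v \<in> S" "card (nbs S) \<le> score S v + 2 * k + of_bool (m \<noteq> 3 * k)"
    using ex_score_ge[OF assms(1-3)] by auto
  have "card (nbs S) = card (nbs (S - {u})) + score S u"
    using g u by (intro card_nbs_split) (auto simp: grown_def)
  then have "card (nbs (S - {u})) \<le> 2 * k + of_bool (m \<noteq> 3 * k)"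
    using v max[OF v(1)] by linarith
  \<comment> \<open>\<open>2 * b \<ge> m + k \<ge> 4 * k\<close>; if \<open>m > 3 * k\<close>, the
    second inequality is strict and \<open>b \<ge> 2 * k + 1\<close> by parity.\<close>
  then show ?thesis using assms(4,5) by (cases "m = 3 * k") simp_all
qed

lemma card_nbs_le: "S \<subseteq> X \<Longrightarrow> card (nbs S) \<le> 3 * card S"
proof -
  assume S: "S \<subseteq> X"
  have "card (nbs S) \<le> (\<Sum>v\<in>S. card (nb v))"
    unfolding nbs_def using finite_subset[OF S finite_X] by (rule card_UN_le)
  also have "\<dots> = (\<Sum>v\<in>S. 3)" using S card_nb X_less by (intro sum.cong) auto
  finally show ?thesis by simp
qed

text \<open>The invariant of the shrinking phase. For \<open>k \<le> 1\<close> it starts from three vertices, and the bound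
  on the neighbourhood is trivial in the end.\<close>

definition shrunk :: "nat \<Rightarrow> nat \<Rightarrow> nat set \<Rightarrow> bool" where
  "shrunk k b S \<longleftrightarrow> S \<subseteq> X \<and> k \<le> card S \<and> card S \<le> k + 3 \<and>
     (2 \<le> k \<longrightarrow> grown k S \<and> card S = k + 1 \<or> card S = k \<and> card (nbs S) \<le> b)"

lemma shrunk_remove:
  assumes s: "shrunk k b S" and "k < card S" "3 * k \<le> m" "m + k \<le> 2 * b"
    and u: "u \<in> S" and max: "\<And>v. v \<in> S \<Longrightarrow> score S v \<le> score S u"
  shows "shrunk k b (S - {u})"
proof -
  have "S \<subseteq> X" using s by (auto simp: shrunk_def)
  then have c: "card (S - {u}) = card S - 1" using u by simp
  show ?thesis
  proof (cases "2 \<le> k")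
    case True
    then have "grown k S" "card S = k + 1" using s assms(2) by (auto simp: shrunk_def)
    then have "card (nbs (S - {u})) \<le> b" using grown_remove[OF _ _ True] assms by blast
    then show ?thesis using s c \<open>card S = k + 1\<close> by (auto simp: shrunk_def)
  next
    case False
    then show ?thesis using s c assms(2) by (auto simp: shrunk_def)
  qed
qed

text \<open>For \<open>k \<le> 1\<close> the bound \<open>3 * k\<close> suffices: if
  \<open>k = 1\<close>, then \<open>m \<ge> 4\<close> and \<open>m + 1 \<le> 2 * b\<close> force
  \<open>b \<ge> 3\<close>. This is the point where the graph with \<open>m = 3\<close> would
  fail.\<close>

lemma shrunk_final:
  assumes s: "shrunk k b S" and "card S = k" "m + k \<le> 2 * b"
  shows "card (nbs S) \<le> b"
proof (cases "2 \<le> k")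
  case True
  then show ?thesis using s assms by (auto simp: shrunk_def)
next
  case False
  moreover have "card (nbs S) \<le> 3 * k" using s assms card_nbs_le by (auto simp: shrunk_def)
  ultimately show ?thesis using assms m_ge_4 by linarith
qed

end

section \<open>Total correctness with time bounds\<close>

text \<open>The step bound is a fixed number, and both conditions speak of one state only; values to
  be remembered across a program have to be fixed as parameters, for which \<open>hoare_ex\<close>
  is the tool.\<close>

definition hoare :: "(state \<Rightarrow> bool) \<Rightarrow> com \<Rightarrow> nat \<Rightarrow> (state \<Rightarrow> bool) \<Rightarrow> bool" where
  "hoare P c t Q \<longleftrightarrow> (\<forall>\<sigma>. P \<sigma> \<longrightarrow> (\<exists>t' \<sigma>'. exec c \<sigma> t' \<sigma>' \<and> t' \<le> t \<and> Q \<sigma>'))"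

lemma hoareI:
  "(\<And>\<sigma>. P \<sigma> \<Longrightarrow> \<exists>t' \<sigma>'. exec c \<sigma> t' \<sigma>' \<and> t' \<le> t \<and> Q \<sigma>') \<Longrightarrow> hoare P c t Q"
  by (simp add: hoare_def)

lemma hoareD:
  "hoare P c t Q \<Longrightarrow> P \<sigma> \<Longrightarrow> \<exists>t' \<sigma>'. exec c \<sigma> t' \<sigma>' \<and> t' \<le> t \<and> Q \<sigma>'"
  by (simp add: hoare_def)

lemma hoare_conseq:
  assumes "hoare P c t Q" "\<And>\<sigma>. P' \<sigma> \<Longrightarrow> P \<sigma>" "\<And>\<sigma>. Q \<sigma> \<Longrightarrow> Q' \<sigma>" "t \<le> t'"
  shows "hoare P' c t' Q'"
  using assms unfolding hoare_def by (meson order.trans)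

lemma hoare_ex: "(\<And>x. hoare (P x) c t Q) \<Longrightarrow> hoare (\<lambda>\<sigma>. \<exists>x. P x \<sigma>) c t Q"
  by (auto simp: hoare_def)

lemma hoare_Seq: "hoare P c t Q \<Longrightarrow> hoare Q d u R \<Longrightarrow> hoare P (Seq c d) (t + u) R"
  unfolding hoare_def by (meson exec.Seq add_mono)

text \<open>The parameter \<open>j\<close> records the measure before the body, which the
  postcondition could not mention otherwise. Each of the at most \<open>M\<close> rounds costs a
  test besides the body; the final \<open>+ 1\<close> is the failing test.\<close>

lemma hoare_Loop:
  fixes \<mu> :: "state \<Rightarrow> nat"
  assumes body: "\<And>j. hoare (\<lambda>\<sigma>. I \<sigma> \<and> bval b \<sigma> \<and> \<mu> \<sigma> = j) c t (\<lambda>\<sigma>. I \<sigma> \<and> \<mu> \<sigma> < j)"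
  shows "hoare (\<lambda>\<sigma>. I \<sigma> \<and> \<mu> \<sigma> \<le> M) (Loop b c) (M * (t + 1) + 1) (\<lambda>\<sigma>. I \<sigma> \<and> \<not> bval b \<sigma>)"
proof (induction M)
  case 0
  \<comment> \<open>At measure 0 a true test would let the body reach a measure below 0.\<close>
  have "\<not> bval b \<sigma>" if "I \<sigma>" "\<mu> \<sigma> = 0" for \<sigma>
    using hoareD[OF body[of 0], of \<sigma>] that by auto
  then show ?case using exec.LoopFalse by (intro hoareI) fastforce
next
  case (Suc M)
  show ?case
  proof (intro hoareI)
    fix \<sigma> assume \<sigma>: "I \<sigma> \<and> \<mu> \<sigma> \<le> Suc M"
    show "\<exists>t' \<sigma>'. exec (Loop b c) \<sigma> t' \<sigma>' \<and> t' \<le> Suc M * (t + 1) + 1 \<and> I \<sigma>' \<and> \<not> bval b \<sigma>'"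
    proof (cases "bval b \<sigma>")
      case True
      with \<sigma> obtain t1 \<sigma>1 where 1: "exec c \<sigma> t1 \<sigma>1" "t1 \<le> t" "I \<sigma>1" "\<mu> \<sigma>1 < \<mu> \<sigma>"
        using hoareD[OF body[of "\<mu> \<sigma>"], of \<sigma>] by auto
      moreover have "\<mu> \<sigma>1 \<le> M" using 1 \<sigma> by linarith
      ultimately obtain t2 \<sigma>2 where 2: "exec (Loop b c) \<sigma>1 t2 \<sigma>2" "t2 \<le> M * (t + 1) + 1"
          "I \<sigma>2" "\<not> bval b \<sigma>2"
        using hoareD[OF Suc, of \<sigma>1] by auto
      have "exec (Loop b c) \<sigma> (1 + t1 + t2) \<sigma>2" using exec.LoopTrue True 1 2 by blast
      moreover have "1 + t1 + t2 \<le> Suc M * (t + 1) + 1" using 1 2 by simp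
      ultimately show ?thesis using 2 by blast
    next
      case False
      then show ?thesis using \<sigma> exec.LoopFalse[OF False, of c] by force
    qed
  qed
qed

section \<open>Symbolic evaluation of loop-free code\<close>

primrec loop_free :: "com \<Rightarrow> bool" where
  "loop_free Skip \<longleftrightarrow> True"
| "loop_free (Assign x e) \<longleftrightarrow> True"
| "loop_free (Store a e f) \<longleftrightarrow> True"
| "loop_free (RAssign x r) \<longleftrightarrow> True"
| "loop_free (Seq c d) \<longleftrightarrow> loop_free c \<and> loop_free d"
| "loop_free (Cond b c d) \<longleftrightarrow> loop_free c \<and> loop_free d"
| "loop_free (Loop b c) \<longleftrightarrow> False"

text \<open>Denotes the final state under \<open>loop_free\<close>; a loop receives a default
  value.\<close>

primrec run :: "com \<Rightarrow> state \<Rightarrow> state" where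
  "run Skip \<sigma> = \<sigma>"
| "run (Assign x e) \<sigma> = \<sigma>\<lparr>nat_of := (nat_of \<sigma>)(x := nval e \<sigma>)\<rparr>"
| "run (Store a e f) \<sigma> =
    \<sigma>\<lparr>arr_of := (arr_of \<sigma>)(a := (arr_of \<sigma> a)(nval e \<sigma> := nval f \<sigma>))\<rparr>"
| "run (RAssign x r) \<sigma> = \<sigma>\<lparr>real_of := (real_of \<sigma>)(x := rval r \<sigma>)\<rparr>"
| "run (Seq c d) \<sigma> = run d (run c \<sigma>)"
| "run (Cond b c d) \<sigma> = (if bval b \<sigma> then run c \<sigma> else run d \<sigma>)"
| "run (Loop b c) \<sigma> = \<sigma>"

primrec cost :: "com \<Rightarrow> nat" where
  "cost Skip = 1"
| "cost (Assign x e) = 1"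
| "cost (Store a e f) = 1"
| "cost (RAssign x r) = 1"
| "cost (Seq c d) = cost c + cost d"
| "cost (Cond b c d) = 1 + max (cost c) (cost d)"
| "cost (Loop b c) = 1"

lemma exec_run: "loop_free c \<Longrightarrow> \<exists>t\<le>cost c. exec c \<sigma> t (run c \<sigma>)"
proof (induction c arbitrary: \<sigma>)
  case (Seq c d)
  then obtain t u where "t \<le> cost c" "exec c \<sigma> t (run c \<sigma>)"
    "u \<le> cost d" "exec d (run c \<sigma>) u (run d (run c \<sigma>))" by fastforce
  then show ?case using exec.Seq by (fastforce intro: exI[of _ "t + u"])
next
  case (Cond b c d)
  show ?case
  proof (cases "bval b \<sigma>")
    case True
    then obtain t where "t \<le> cost c" "exec c \<sigma> t (run c \<sigma>)" using Cond by fastforce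
    then show ?thesis using exec.CondTrue[OF True] True by (fastforce intro: exI[of _ "1 + t"])
  next
    case False
    then obtain t where "t \<le> cost d" "exec d \<sigma> t (run d \<sigma>)" using Cond by fastforce
    then show ?thesis using exec.CondFalse[OF False] False by (fastforce intro: exI[of _ "1 + t"])
  qed
qed (auto intro: exec.intros exI[of _ 1])

text \<open>Turns a triple for loop-free code into a simplification problem: \<open>run\<close>
  computes the final state, and \<open>cost\<close> charges the dearer branch of each
  conditional.\<close>

lemma hoare_run:
  assumes "loop_free c" "\<And>\<sigma>. P \<sigma> \<Longrightarrow> Q (run c \<sigma>)" "cost c \<le> t"
  shows "hoare P c t Q"
proof (rule hoareI)
  fix \<sigma> assume "P \<sigma>"
  moreover obtain t' where "t' \<le> cost c" "exec c \<sigma> t' (run c \<sigma>)"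
    using exec_run[OF assms(1)] by auto
  ultimately show "\<exists>t' \<sigma>'. exec c \<sigma> t' \<sigma>' \<and> t' \<le> t \<and> Q \<sigma>'"
    using assms(2,3) order.trans by blast
qed

primrec nat_writes :: "com \<Rightarrow> vname set" where
  "nat_writes Skip = {}"
| "nat_writes (Assign x e) = {x}"
| "nat_writes (Store a e f) = {}"
| "nat_writes (RAssign x r) = {}"
| "nat_writes (Seq c d) = nat_writes c \<union> nat_writes d"
| "nat_writes (Cond b c d) = nat_writes c \<union> nat_writes d"
| "nat_writes (Loop b c) = nat_writes c"

lemma exec_nat_writes: "exec c \<sigma> t \<tau> \<Longrightarrow> x \<notin> nat_writes c \<Longrightarrow> nat_of \<tau> x = nat_of \<sigma> x"
  by (induction rule: exec.induct) auto

text \<open>Carries a remembered value past code that never assigns to \<open>x\<close>; it serves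
  the loop counters and the vertex \<open>y\<close> during seeding.\<close>

lemma hoare_frame:
  assumes "hoare P c t Q" "x \<notin> nat_writes c"
  shows "hoare (\<lambda>\<sigma>. P \<sigma> \<and> nat_of \<sigma> x = k) c t (\<lambda>\<sigma>. Q \<sigma> \<and> nat_of \<sigma> x = k)"
  using assms exec_nat_writes unfolding hoare_def by metis

definition For :: "vname \<Rightarrow> com \<Rightarrow> com" where
  "For i c = Seq (Assign i (Const 0))
     (Loop (NLess (Var i) (Var ''n'')) (Seq c (Assign i (Add (Var i) (Const 1)))))"

abbreviation set_nat :: "vname \<Rightarrow> nat \<Rightarrow> state \<Rightarrow> state" where
  "set_nat x l \<sigma> \<equiv> \<sigma>\<lparr>nat_of := (nat_of \<sigma>)(x := l)\<rparr>"

text \<open>A round consists of test, body and increment; the extra 2 are the initialisation and the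
  last test. The premise \<open>frame\<close> makes \<open>I\<close> insensitive to the counter
  variable, whose value is the first argument of \<open>I\<close> instead.\<close>

lemma hoare_For:
  assumes i: "i \<noteq> ''n''" "i \<notin> nat_writes c"
    and n: "\<And>k \<sigma>. I k \<sigma> \<Longrightarrow> nat_of \<sigma> ''n'' = n"
    and frame: "\<And>k l \<sigma>. I k \<sigma> \<Longrightarrow> I k (set_nat i l \<sigma>)"
    and body: "\<And>k. k < n \<Longrightarrow> hoare (\<lambda>\<sigma>. I k \<sigma> \<and> nat_of \<sigma> i = k) c t (I (Suc k))"
  shows "hoare (I 0) (For i c) (n * (t + 2) + 2) (I n)"
proof -
  let ?J = "\<lambda>\<sigma>. nat_of \<sigma> i \<le> n \<and> I (nat_of \<sigma> i) \<sigma>"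
  have "hoare ?J (Loop (NLess (Var i) (Var ''n'')) (Seq c (Assign i (Add (Var i) (Const 1)))))
      (n * (t + 1 + 1) + 1) (\<lambda>\<sigma>. ?J \<sigma> \<and> \<not> bval (NLess (Var i) (Var ''n'')) \<sigma>)"
  proof (rule hoare_conseq[OF hoare_Loop[where \<mu> = "\<lambda>\<sigma>. n - nat_of \<sigma> i" and M = n]])
    fix j
    show "hoare (\<lambda>\<sigma>. ?J \<sigma> \<and> bval (NLess (Var i) (Var ''n'')) \<sigma> \<and> n - nat_of \<sigma> i = j)
      (Seq c (Assign i (Add (Var i) (Const 1)))) (t + 1) (\<lambda>\<sigma>. ?J \<sigma> \<and> n - nat_of \<sigma> i < j)"
    \<comment> \<open>The counter has the value \<open>n - j\<close>; for any other \<open>j\<close>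
      the precondition is unsatisfiable.\<close>
    proof (cases "0 < j \<and> j \<le> n")
      case True
      have "hoare (\<lambda>\<sigma>. I (n - j) \<sigma> \<and> nat_of \<sigma> i = n - j) (Seq c (Assign i (Add (Var i) (Const 1))))
          (t + 1) (\<lambda>\<sigma>. ?J \<sigma> \<and> n - nat_of \<sigma> i < j)"
      proof (rule hoare_Seq)
        show "hoare (\<lambda>\<sigma>. I (n - j) \<sigma> \<and> nat_of \<sigma> i = n - j) c t
          (\<lambda>\<sigma>. I (Suc (n - j)) \<sigma> \<and> nat_of \<sigma> i = n - j)"
          using hoare_frame[OF body[of "n - j"] i(2), of "n - j"] True
          by (auto elim!: hoare_conseq)
        show "hoare (\<lambda>\<sigma>. I (Suc (n - j)) \<sigma> \<and> nat_of \<sigma> i = n - j)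
          (Assign i (Add (Var i) (Const 1))) 1 (\<lambda>\<sigma>. ?J \<sigma> \<and> n - nat_of \<sigma> i < j)"
          using True frame[of "Suc (n - j)"] by (intro hoare_run) auto
      qed
      then show ?thesis
        by (rule hoare_conseq) (auto dest: n)
    next
      case False
      then show ?thesis by (intro hoareI) (auto dest: n)
    qed
  qed auto
  moreover have "hoare (I 0) (Assign i (Const 0)) 1 ?J"
    using frame by (intro hoare_run) auto
  ultimately have "hoare (I 0) (For i c) (1 + (n * (t + 1 + 1) + 1))
      (\<lambda>\<sigma>. ?J \<sigma> \<and> \<not> bval (NLess (Var i) (Var ''n'')) \<sigma>)"
    unfolding For_def by (intro hoare_Seq)
  then show ?thesis
    by (rule hoare_conseq) (use n le_antisym in \<open>fastforce+\<close>)
qed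

section \<open>Load sizes\<close>

lemma machines_ball: "(\<forall>i\<in>machines. P i) \<longleftrightarrow> P 1 \<and> P 2 \<and> P 3"
  and machines_bex: "(\<exists>i\<in>machines. P i) \<longleftrightarrow> P 1 \<or> P 2 \<or> P 3"
  by (auto simp: machines_def)

locale speeds =
  fixes n :: nat and s :: "nat \<Rightarrow> real"
  assumes s12: "s 2 \<le> s 1" and s23: "s 3 \<le> s 2" and s3: "0 < s 3"
begin

lemma s_pos: "i \<in> machines \<Longrightarrow> 0 < s i"
  using s12 s23 s3 by (auto simp: machines_def)

text \<open>A comparison of maximal completion times that avoids \<open>Max\<close>. Requiring a
  total of at least \<open>r\<close> keeps every competitor for \<open>Suc r\<close> a competitor
  for \<open>r\<close>.\<close>

definition optimal_sizes :: "nat \<Rightarrow> (nat \<Rightarrow> nat) \<Rightarrow> bool" where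
  "optimal_sizes r x \<longleftrightarrow> (\<forall>y. (\<forall>i\<in>machines. 2 * y i \<le> n) \<longrightarrow> r \<le> y 1 + y 2 + y 3 \<longrightarrow>
     (\<forall>i\<in>machines. \<exists>j\<in>machines. real (x i) / s i \<le> real (y j) / s j))"

definition least_loaded :: "(nat \<Rightarrow> nat) \<Rightarrow> nat \<Rightarrow> bool" where
  "least_loaded x k \<longleftrightarrow> 2 * x k < n \<and>
     (\<forall>j\<in>machines. 2 * x j < n \<longrightarrow> real (x k + 1) / s k \<le> real (x j + 1) / s j)"

lemma ex_least_loaded:
  assumes "x 1 + x 2 + x 3 < n"
  shows "\<exists>k\<in>machines. least_loaded x k"
proof -
  let ?A = "{j \<in> machines. 2 * x j < n}"
  have "2 * x 1 < n \<or> 2 * x 2 < n \<or> 2 * x 3 < n" using assms by linarith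
  then have "?A \<noteq> {}" by (auto simp: machines_def)
  moreover have "finite ?A" by (simp add: machines_def)
  ultimately obtain k where "k \<in> ?A" "\<forall>j\<in>?A. real (x k + 1) / s k \<le> real (x j + 1) / s j"
    using ex_min_if_finite[of "(\<lambda>j. real (x j + 1) / s j) ` ?A"] by fastforce
  then show ?thesis by (auto simp: least_loaded_def)
qed

text \<open>Between machines of equal load the faster one is at least as good; this is what keeps
  the greedy sizes sorted.\<close>

lemma least_loaded_le:
  assumes "i \<in> machines" "j \<in> machines" "least_loaded x j" "x i = x j" "s j \<le> s i"
  shows "least_loaded x i"
proof -
  have "real (x i + 1) / s i \<le> real (x j + 1) / s j"
    using assms s_pos by (simp add: frac_le)
  then show ?thesis using assms unfolding least_loaded_def by fastforce
qed

lemma optimal_sizes_0: "optimal_sizes 0 (\<lambda>_. 0)"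
  unfolding optimal_sizes_def using s_pos by (fastforce simp: machines_def)

lemma optimal_sizes_step:
  assumes opt: "optimal_sizes r x" and sum: "x 1 + x 2 + x 3 = r"
    and k: "k \<in> machines" "least_loaded x k"
  shows "optimal_sizes (Suc r) (x(k := x k + 1))"
  unfolding optimal_sizes_def
proof (intro allI impI ballI)
  fix y i
  assume y: "\<forall>i\<in>machines. 2 * y i \<le> n" "Suc r \<le> y 1 + y 2 + y 3" and i: "i \<in> machines"
  show "\<exists>j\<in>machines. real ((x(k := x k + 1)) i) / s i \<le> real (y j) / s j"
  proof (cases "i = k")
    case False
    have "r \<le> y 1 + y 2 + y 3" using y(2) by simp
    then show ?thesis using opt y(1) i False unfolding optimal_sizes_def by simp
  next
    case True
    \<comment> \<open>Pigeonhole: \<open>y\<close> holds more jobs than \<open>x\<close>, so it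
      exceeds \<open>x\<close> on some machine. That machine has room left in \<open>x\<close>, and
      the greedy choice \<open>k\<close> finishes no later than it would.\<close>
    have "x 1 < y 1 \<or> x 2 < y 2 \<or> x 3 < y 3" using y(2) sum by linarith
    then obtain j where j: "j \<in> machines" "x j < y j" by (auto simp: machines_def)
    then have "2 * x j < n" using y(1) by fastforce
    then have "real (x k + 1) / s k \<le> real (x j + 1) / s j"
      using k(2) j(1) by (auto simp: least_loaded_def)
    also have "\<dots> \<le> real (y j) / s j" using j s_pos[of j] by (intro divide_right_mono) auto
    finally show ?thesis using True j by auto
  qed
qed

lemma Cmax_le_iff: "Cmax s I \<le> t \<longleftrightarrow> (\<forall>i\<in>machines. real (card (I i)) / s i \<le> t)"
  unfolding Cmax_def by (subst Max_le_iff) (auto simp: machines_def)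

lemma Cmax_ge: "j \<in> machines \<Longrightarrow> real (card (J j)) / s j \<le> Cmax s J"
  unfolding Cmax_def by (intro Max_ge) (auto simp: machines_def)

lemma optimal_sizes_Cmax_le:
  assumes "optimal_sizes n x" "\<And>i. i \<in> machines \<Longrightarrow> card (I i) = x i"
    and "\<And>i. i \<in> machines \<Longrightarrow> 2 * card (J i) \<le> n" "card (J 1) + card (J 2) + card (J 3) = n"
  shows "Cmax s I \<le> Cmax s J"
  unfolding Cmax_le_iff
proof
  fix i assume i: "i \<in> machines"
  have "\<forall>i\<in>machines. \<exists>j\<in>machines. real (x i) / s i \<le> real (card (J j)) / s j"
    using assms(1,3,4) unfolding optimal_sizes_def by simp
  then obtain j where "j \<in> machines" "real (card (I i)) / s i \<le> real (card (J j)) / s j"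
    using i assms(2) by auto
  then show "real (card (I i)) / s i \<le> Cmax s J" using Cmax_ge[of j J] by linarith
qed

end

section \<open>The program\<close>

text \<open>Index \<open>3 * x + j\<close>, spelled with additions because expressions have no
  product.\<close>

abbreviation Nbr :: "nat \<Rightarrow> vname \<Rightarrow> nexp" where
  "Nbr j x \<equiv> Elem ''adj'' (Add (Add (Var x) (Var x)) (Add (Var x) (Const j)))"

abbreviation At :: "vname \<Rightarrow> vname \<Rightarrow> nexp" where
  "At a x \<equiv> Elem a (Var x)"

text \<open>Mark 0 means unknown, 1 the side of vertex 0 and 2 the other side; subtraction from 3
  swaps the sides.\<close>

definition colour_body :: com where
  "colour_body =
    (let e = Sub (Const 3) (At ''side'' ''v'') in
     Cond (NLess (Const 0) (At ''side'' ''v''))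
       (Seq (Store ''side'' (Nbr 0 ''v'') e)
       (Seq (Store ''side'' (Nbr 1 ''v'') e)
         (Store ''side'' (Nbr 2 ''v'') e)))
       Skip)"

definition colour :: com where
  "colour = Seq (Store ''side'' (Const 0) (Const 1)) (For ''r'' (For ''v'' colour_body))"

text \<open>The real variable \<open>pij\<close> holds \<open>(xi + 1) * s j\<close>, which turns the comparison of
  \<open>(xi + 1) / s i\<close> with \<open>(xj + 1) / s j\<close> into one of \<open>pij\<close> with \<open>pji\<close>.\<close>

definition test_load :: "vname \<Rightarrow> vname \<Rightarrow> vname \<Rightarrow> vname \<Rightarrow> vname \<Rightarrow> vname \<Rightarrow> vname \<Rightarrow> bexp" where
  "test_load x y pxy pyx z pxz pzx =
    Conj (NLess (Add (Var x) (Var x)) (Var ''n''))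
      (Conj (Neg (Conj (NLess (Add (Var y) (Var y)) (Var ''n'')) (RLess (RVar pyx) (RVar pxy))))
        (Neg (Conj (NLess (Add (Var z) (Var z)) (Var ''n'')) (RLess (RVar pzx) (RVar pxz)))))"

definition add_load :: "vname \<Rightarrow> vname \<Rightarrow> vname \<Rightarrow> vname \<Rightarrow> vname \<Rightarrow> com" where
  "add_load x pxy sy pxz sz =
    Seq (Assign x (Add (Var x) (Const 1)))
      (Seq (RAssign pxy (RAdd (RVar pxy) (RVar sy))) (RAssign pxz (RAdd (RVar pxz) (RVar sz))))"

text \<open>The order of the tests settles ties in favour of the faster machine. Machine 3 is the
  default because some machine qualifies while fewer than \<open>n\<close> jobs are
  distributed.\<close>

definition sizes_body :: com where
  "sizes_body =
    Cond (test_load ''x1'' ''x2'' ''p12'' ''p21'' ''x3'' ''p13'' ''p31'')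
      (add_load ''x1'' ''p12'' ''s2'' ''p13'' ''s3'')
    (Cond (test_load ''x2'' ''x1'' ''p21'' ''p12'' ''x3'' ''p23'' ''p32'')
      (add_load ''x2'' ''p21'' ''s1'' ''p23'' ''s3'')
      (add_load ''x3'' ''p31'' ''s1'' ''p32'' ''s2''))"

definition sizes :: com where
  "sizes =
    Seq (Seq (RAssign ''p12'' (RVar ''s2''))
      (Seq (RAssign ''p13'' (RVar ''s3''))
      (Seq (RAssign ''p21'' (RVar ''s1''))
      (Seq (RAssign ''p23'' (RVar ''s3''))
      (Seq (RAssign ''p31'' (RVar ''s1''))
        (RAssign ''p32'' (RVar ''s2'')))))))
    (For ''r'' sizes_body)"

text \<open>\<open>toggle\<close> moves the vertex \<open>u\<close> into or out of the set \<open>S\<close> whose indicator is the array \<open>sel\<close>;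
  \<open>cnt\<close> counts the neighbours in \<open>S\<close> and \<open>z\<close> is the size of \<open>S\<close>.\<close>

abbreviation shifted :: "nexp \<Rightarrow> nexp" where
  "shifted e \<equiv> Sub (Add e (Const 1)) (Add (At ''sel'' ''u'') (At ''sel'' ''u''))"

definition toggle :: com where
  "toggle =
    Seq (Store ''cnt'' (Nbr 0 ''u'') (shifted (Elem ''cnt'' (Nbr 0 ''u''))))
    (Seq (Store ''cnt'' (Nbr 1 ''u'') (shifted (Elem ''cnt'' (Nbr 1 ''u''))))
    (Seq (Store ''cnt'' (Nbr 2 ''u'') (shifted (Elem ''cnt'' (Nbr 2 ''u''))))
    (Seq (Assign ''z'' (shifted (Var ''z'')))
      (Store ''sel'' (Var ''u'') (Sub (Const 1) (At ''sel'' ''u''))))))"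

text \<open>An equality test with value 0 or 1: the result is 1 exactly if both truncated
  differences vanish.\<close>

definition Eq :: "nexp \<Rightarrow> nexp \<Rightarrow> nexp" where
  "Eq e f = Sub (Sub (Const 1) (Sub e f)) (Sub f e)"

text \<open>A neighbour is private to \<open>v\<close> if its count is 0 with \<open>v\<close>
  outside \<open>S\<close>, or 1 with \<open>v\<close> inside; comparing the count with
  \<open>sel\<close> at \<open>v\<close> serves both phases.\<close>

definition Score :: nexp where
  "Score = Add (Eq (Elem ''cnt'' (Nbr 0 ''v'')) (At ''sel'' ''v''))
    (Add (Eq (Elem ''cnt'' (Nbr 1 ''v'')) (At ''sel'' ''v''))
      (Eq (Elem ''cnt'' (Nbr 2 ''v'')) (At ''sel'' ''v'')))"

definition times4 :: "nexp \<Rightarrow> nexp" where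
  "times4 e = Add (Add e e) (Add e e)"

text \<open>A key of at least 4 disqualifies a vertex.\<close>

definition grow_key :: nexp where
  "grow_key = Add Score (times4 (Add (Sub (At ''side'' ''v'') (Const 1)) (At ''sel'' ''v'')))"

definition shrink_key :: nexp where
  "shrink_key = Add (Sub (Const 3) Score) (times4 (Sub (Const 1) (At ''sel'' ''v'')))"

definition scan_body :: "nexp \<Rightarrow> com" where
  "scan_body K = Cond (NLess K (Var ''best''))
    (Seq (Assign ''best'' K) (Assign ''u'' (Var ''v''))) Skip"

definition scan :: "nexp \<Rightarrow> com" where
  "scan K = Seq (Assign ''best'' (Const 4)) (For ''v'' (scan_body K))"

text \<open>Entry 0 of \<open>adj\<close> is a neighbour of vertex 0, hence lies in
  \<open>Y\<close>; its three neighbours form the start set.\<close>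

definition seed :: com where
  "seed =
    Seq (Assign ''y'' (Elem ''adj'' (Const 0)))
    (Seq (Seq (Assign ''u'' (Nbr 0 ''y'')) toggle)
    (Seq (Seq (Assign ''u'' (Nbr 1 ''y'')) toggle)
      (Seq (Assign ''u'' (Nbr 2 ''y'')) toggle)))"

text \<open>With \<open>k = n / 2 - x1\<close>, hence \<open>2 * k = x2 + x3 - x1\<close>, the loops run while \<open>z \<le> k\<close> and
  while \<open>z > k\<close>, respectively.\<close>

definition grow :: com where
  "grow = Loop (NLess (Add (Add (Var ''z'') (Var ''z'')) (Var ''x1''))
      (Add (Add (Var ''x2'') (Var ''x3'')) (Const 2)))
    (Seq (scan grow_key) toggle)"

definition shrink :: com where
  "shrink = Loop (NLess (Add (Var ''x2'') (Var ''x3''))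
      (Add (Add (Var ''z'') (Var ''z'')) (Var ''x1'')))
    (Seq (scan shrink_key) toggle)"

definition place_body :: com where
  "place_body =
    Cond (NLess (At ''side'' ''v'') (Const 2))
      (Store ''machine'' (Var ''v'') (Add (Const 1) (Add (At ''sel'' ''v'') (At ''sel'' ''v''))))
    (Cond (NLess (Const 0) (At ''cnt'' ''v''))
      (Seq (Store ''machine'' (Var ''v'') (Const 2)) (Assign ''q'' (Add (Var ''q'') (Const 1))))
      Skip)"

definition fill_body :: com where
  "fill_body =
    Cond (NLess (At ''machine'' ''v'') (Const 1))
      (Cond (NLess (Var ''q'') (Var ''x2''))
        (Seq (Store ''machine'' (Var ''v'') (Const 2)) (Assign ''q'' (Add (Var ''q'') (Const 1))))
        (Store ''machine'' (Var ''v'') (Const 3)))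
      Skip"

definition program :: com where
  "program = Seq colour (Seq sizes (Seq seed (Seq grow (Seq shrink
     (Seq (For ''v'' place_body) (For ''v'' fill_body))))))"

section \<open>Correctness of the program\<close>

text \<open>Since some key is below 4, \<open>best\<close> ends below its initial value 4, so
  \<open>u\<close> has been assigned and is a minimiser.\<close>

lemma hoare_scan:
  assumes n: "\<And>\<sigma>. F \<sigma> \<Longrightarrow> nat_of \<sigma> ''n'' = n"
    and frame: "\<And>\<sigma> x l. F \<sigma> \<Longrightarrow> x \<in> {''best'', ''u'', ''v''} \<Longrightarrow> F (set_nat x l \<sigma>)"
    and key: "\<And>\<sigma>. F \<sigma> \<Longrightarrow> nat_of \<sigma> ''v'' < n \<Longrightarrow> nval K \<sigma> = \<kappa> (nat_of \<sigma> ''v'')"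
    and ex: "\<exists>v<n. \<kappa> v < 4"
  shows "hoare F (scan K) (n * 5 + 3)
    (\<lambda>\<sigma>. F \<sigma> \<and> nat_of \<sigma> ''u'' < n \<and> (\<forall>v<n. \<kappa> (nat_of \<sigma> ''u'') \<le> \<kappa> v))"
proof -
  let ?I = "\<lambda>i \<sigma>. F \<sigma> \<and> (\<forall>v<i. nat_of \<sigma> ''best'' \<le> \<kappa> v) \<and>
    (nat_of \<sigma> ''best'' < 4 \<longrightarrow> nat_of \<sigma> ''u'' < n \<and> nat_of \<sigma> ''best'' = \<kappa> (nat_of \<sigma> ''u'')) \<and>
    nat_of \<sigma> ''best'' \<le> 4"
  have "hoare F (Assign ''best'' (Const 4)) 1 (?I 0)"
    using frame by (intro hoare_run) auto
  moreover have "hoare (?I 0) (For ''v'' (scan_body K)) (n * (3 + 2) + 2) (?I n)"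
  proof (rule hoare_For)
    fix i assume i: "i < n"
    show "hoare (\<lambda>\<sigma>. ?I i \<sigma> \<and> nat_of \<sigma> ''v'' = i) (scan_body K) 3 (?I (Suc i))"
    proof (rule hoare_run)
      fix \<sigma> assume \<sigma>: "?I i \<sigma> \<and> nat_of \<sigma> ''v'' = i"
      have K: "nval K \<sigma> = \<kappa> i" using key[of \<sigma>] \<sigma> i by simp
      have "F (set_nat ''best'' (\<kappa> i) \<sigma>)" using frame \<sigma> by simp
      then have "F (set_nat ''u'' i (set_nat ''best'' (\<kappa> i) \<sigma>))" using frame by blast
      then show "?I (Suc i) (run (scan_body K) \<sigma>)"
        using \<sigma> K i unfolding scan_body_def by (auto simp: less_Suc_eq)
    qed (simp_all add: scan_body_def)
  qed (use frame n in \<open>auto simp: scan_body_def\<close>)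
  ultimately have "hoare F (scan K) (1 + (n * (3 + 2) + 2)) (?I n)"
    unfolding scan_def by (rule hoare_Seq)
  then show ?thesis
    by (rule hoare_conseq) (use ex in fastforce)+
qed

locale cubic_input = bicubic_not_K33 n nb X Y + speeds n s
  for n nb X Y and s :: "nat \<Rightarrow> real" +
  fixes A :: "nat \<Rightarrow> nat"
  assumes nb_adj: "v < n \<Longrightarrow> nb v = {A (v + v + v), A (v + v + Suc v), A (v + v + Suc (Suc v))}"
begin

section \<open>Recovering the two sides\<close>

definition side :: "nat \<Rightarrow> nat" where
  "side v = (if v \<in> X then 1 else 2)"

lemma side_nb: "v < n \<Longrightarrow> w \<in> nb v \<Longrightarrow> side w = 3 - side v"
  using nb_X[of v] nb_Y[of v] verts disjoint unfolding side_def by fastforce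

lemma nb_irrefl: "v < n \<Longrightarrow> v \<notin> nb v"
  using nb_X[of v] nb_Y[of v] verts disjoint by fastforce

lemma n_pos: "0 < n"
  using zero_X X_less by auto

text \<open>Collects what survives both the colouring and the size computation;
  \<open>untouched_sizes\<close> is separate because the latter destroys it.\<close>

definition initial :: "state \<Rightarrow> bool" where
  "initial \<sigma> \<longleftrightarrow> nat_of \<sigma> ''n'' = n \<and> arr_of \<sigma> ''adj'' = A \<and>
     arr_of \<sigma> ''sel'' = (\<lambda>_. 0) \<and> arr_of \<sigma> ''cnt'' = (\<lambda>_. 0) \<and> arr_of \<sigma> ''machine'' = (\<lambda>_. 0) \<and>
     nat_of \<sigma> ''z'' = 0 \<and> nat_of \<sigma> ''q'' = 0"

definition untouched_sizes :: "state \<Rightarrow> bool" where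
  "untouched_sizes \<sigma> \<longleftrightarrow> nat_of \<sigma> ''x1'' = 0 \<and> nat_of \<sigma> ''x2'' = 0 \<and> nat_of \<sigma> ''x3'' = 0 \<and>
     real_of \<sigma> ''s1'' = s 1 \<and> real_of \<sigma> ''s2'' = s 2 \<and> real_of \<sigma> ''s3'' = s 3"

definition coloured :: "(nat \<Rightarrow> nat) \<Rightarrow> nat set \<Rightarrow> bool" where
  "coloured f C \<longleftrightarrow> C \<subseteq> {0..<n} \<and> 0 \<in> C \<and> (\<forall>v<n. f v = (if v \<in> C then side v else 0))"

lemma coloured_nb:
  assumes "coloured f C" "v \<in> C"
  shows "coloured (f(A (v + v + v) := 3 - f v, A (v + v + Suc v) := 3 - f v,
    A (v + v + Suc (Suc v)) := 3 - f v)) (C \<union> nb v)"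
proof -
  have v: "v < n" using assms by (auto simp: coloured_def)
  then have f: "3 - f v = side w" if "w \<in> nb v" for w
    using assms side_nb[OF v that] by (auto simp: coloured_def)
  have "nb v \<subseteq> {0..<n}" using nb_less[OF v] by auto
  then show ?thesis
    using assms f unfolding coloured_def by (auto simp: nb_adj[OF v])
qed

text \<open>\<open>C0\<close> is the coloured set at the start of a sweep. Sweeps colour in place,
  so \<open>C\<close> may exceed \<open>C0\<close> and its neighbours; the invariant therefore
  bounds it only from below.\<close>

lemma hoare_colour_body:
  "hoare (\<lambda>\<sigma>. (initial \<sigma> \<and> untouched_sizes \<sigma> \<and> (\<exists>C. coloured (arr_of \<sigma> ''side'') C \<and> C0 \<subseteq> C \<and>
        (\<forall>v\<in>C0. v < i \<longrightarrow> nb v \<subseteq> C))) \<and> nat_of \<sigma> ''v'' = i)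
     colour_body 4
     (\<lambda>\<sigma>. initial \<sigma> \<and> untouched_sizes \<sigma> \<and> (\<exists>C. coloured (arr_of \<sigma> ''side'') C \<and> C0 \<subseteq> C \<and>
        (\<forall>v\<in>C0. v < Suc i \<longrightarrow> nb v \<subseteq> C)))"
  if i: "i < n" and C0: "C0 \<subseteq> {0..<n}"
proof (rule hoare_run)
  fix \<sigma> :: state
  let ?f = "arr_of \<sigma> ''side''"
  assume "(initial \<sigma> \<and> untouched_sizes \<sigma> \<and> (\<exists>C. coloured (arr_of \<sigma> ''side'') C \<and> C0 \<subseteq> C \<and>
        (\<forall>v\<in>C0. v < i \<longrightarrow> nb v \<subseteq> C))) \<and> nat_of \<sigma> ''v'' = i"
  then obtain C where \<sigma>: "initial \<sigma>" "untouched_sizes \<sigma>" "nat_of \<sigma> ''v'' = i"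
    and C: "coloured ?f C" "C0 \<subseteq> C" "\<forall>v\<in>C0. v < i \<longrightarrow> nb v \<subseteq> C" by blast
  have adj: "arr_of \<sigma> ''adj'' = A" using \<sigma> by (simp add: initial_def)
  \<comment> \<open>No vertex is its own neighbour, so the stores do not disturb the mark of
    \<open>i\<close>, which each of them reads anew.\<close>
  have neq: "A (i + i + i) \<noteq> i" "A (i + i + Suc i) \<noteq> i" "A (i + i + Suc (Suc i)) \<noteq> i"
    using nb_irrefl[OF i] nb_adj[OF i] by auto
  let ?\<tau> = "run colour_body \<sigma>"
  have frame: "initial ?\<tau>" "untouched_sizes ?\<tau>"
    using \<sigma> by (auto simp: colour_body_def Let_def initial_def untouched_sizes_def)
  have "\<exists>C. coloured (arr_of ?\<tau> ''side'') C \<and> C0 \<subseteq> C \<and> (\<forall>v\<in>C0. v < Suc i \<longrightarrow> nb v \<subseteq> C)"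
  proof (cases "i \<in> C")
    case True
    then have "0 < ?f i" using C(1) i by (auto simp: coloured_def side_def)
    then have "arr_of ?\<tau> ''side'' = ?f(A (i + i + i) := 3 - ?f i, A (i + i + Suc i) := 3 - ?f i,
        A (i + i + Suc (Suc i)) := 3 - ?f i)"
      using neq adj \<sigma>(3) by (simp add: colour_body_def Let_def)
    then have "coloured (arr_of ?\<tau> ''side'') (C \<union> nb i)" using coloured_nb[OF C(1) True] by simp
    moreover have "\<forall>v\<in>C0. v < Suc i \<longrightarrow> nb v \<subseteq> C \<union> nb i" using C(3) less_Suc_eq by blast
    ultimately show ?thesis using C(2) by blast
  next
    case False
    then have "?f i = 0" using C(1) i by (auto simp: coloured_def)
    then have "?\<tau> = \<sigma>" using \<sigma>(3) by (simp add: colour_body_def Let_def)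
    moreover have "\<forall>v\<in>C0. v < Suc i \<longrightarrow> nb v \<subseteq> C" using C False less_Suc_eq by blast
    ultimately show ?thesis using C by auto
  qed
  with frame show "initial ?\<tau> \<and> untouched_sizes ?\<tau> \<and>
      (\<exists>C. coloured (arr_of ?\<tau> ''side'') C \<and> C0 \<subseteq> C \<and> (\<forall>v\<in>C0. v < Suc i \<longrightarrow> nb v \<subseteq> C))" by blast
qed (simp_all add: colour_body_def Let_def)

definition colour_inv :: "nat \<Rightarrow> state \<Rightarrow> bool" where
  "colour_inv r \<sigma> \<longleftrightarrow> initial \<sigma> \<and> untouched_sizes \<sigma> \<and>
     (\<exists>C. coloured (arr_of \<sigma> ''side'') C \<and> min n (Suc r) \<le> card C)"

text \<open>A sweep that adds no vertex has found a set closed under neighbours, which is everything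
  by connectivity. Otherwise at least one vertex is gained, so \<open>n\<close> sweeps are
  enough.\<close>

lemma hoare_colour_round:
  "hoare (colour_inv r) (For ''v'' colour_body) (n * 6 + 2) (colour_inv (Suc r))"
proof -
  let ?I = "\<lambda>C0 i \<sigma>. initial \<sigma> \<and> untouched_sizes \<sigma> \<and>
    (\<exists>C. coloured (arr_of \<sigma> ''side'') C \<and> C0 \<subseteq> C \<and> (\<forall>v\<in>C0. v < i \<longrightarrow> nb v \<subseteq> C))"
  have "hoare (\<lambda>\<sigma>. \<exists>C0. 0 \<in> C0 \<and> C0 \<subseteq> {0..<n} \<and> min n (Suc r) \<le> card C0 \<and> ?I C0 0 \<sigma>)
      (For ''v'' colour_body) (n * 6 + 2) (colour_inv (Suc r))"
  proof (rule hoare_ex)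
    fix C0
    show "hoare (\<lambda>\<sigma>. 0 \<in> C0 \<and> C0 \<subseteq> {0..<n} \<and> min n (Suc r) \<le> card C0 \<and> ?I C0 0 \<sigma>)
      (For ''v'' colour_body) (n * 6 + 2) (colour_inv (Suc r))"
    proof (cases "0 \<in> C0 \<and> C0 \<subseteq> {0..<n} \<and> min n (Suc r) \<le> card C0")
      case True
      have "hoare (?I C0 0) (For ''v'' colour_body) (n * (4 + 2) + 2) (?I C0 n)"
        using True hoare_colour_body
        by (intro hoare_For) (auto simp: initial_def untouched_sizes_def colour_body_def Let_def)
      then show ?thesis
      proof (rule hoare_conseq)
        fix \<sigma> assume "?I C0 n \<sigma>"
        then obtain C where C: "coloured (arr_of \<sigma> ''side'') C" "C0 \<subseteq> C" "\<forall>v\<in>C0. v < n \<longrightarrow> nb v \<subseteq> C"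
          and \<sigma>: "initial \<sigma>" "untouched_sizes \<sigma>" by blast
        have sub: "C \<subseteq> {0..<n}" using C by (auto simp: coloured_def)
        then have fin: "finite C" using finite_subset by blast
        have "min n (Suc (Suc r)) \<le> card C"
        proof (cases "C = C0")
          case eq: True
          have "C0 = {0..<n}" using True C(3) by (intro closed_eq) (auto simp: eq subset_iff)
          then show ?thesis using eq by simp
        next
          case False
          then have "card C0 < card C" using fin C(2) by (intro psubset_card_mono) auto
          then show ?thesis using True by linarith
        qed
        then show "colour_inv (Suc r) \<sigma>" using C(1) \<sigma> unfolding colour_inv_def by blast
      qed auto
    next
      case False
      then show ?thesis unfolding hoare_def by blast
    qed
  qed
  then show ?thesis
  proof (rule hoare_conseq)
    fix \<sigma> assume "colour_inv r \<sigma>"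
    then obtain C where "initial \<sigma>" "untouched_sizes \<sigma>" "coloured (arr_of \<sigma> ''side'') C"
      "min n (Suc r) \<le> card C" unfolding colour_inv_def by blast
    then show "\<exists>C0. 0 \<in> C0 \<and> C0 \<subseteq> {0..<n} \<and> min n (Suc r) \<le> card C0 \<and> ?I C0 0 \<sigma>"
      by (intro exI[of _ C]) (auto simp: coloured_def)
  qed simp_all
qed

definition sides_known :: "state \<Rightarrow> bool" where
  "sides_known \<sigma> \<longleftrightarrow> (\<forall>v<n. arr_of \<sigma> ''side'' v = side v)"

lemma hoare_colour:
  "hoare (\<lambda>\<sigma>. initial \<sigma> \<and> untouched_sizes \<sigma> \<and> arr_of \<sigma> ''side'' = (\<lambda>_. 0))
     colour (n * (n * 6 + 4) + 3) (\<lambda>\<sigma>. initial \<sigma> \<and> untouched_sizes \<sigma> \<and> sides_known \<sigma>)"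
proof -
  have "hoare (\<lambda>\<sigma>. initial \<sigma> \<and> untouched_sizes \<sigma> \<and> arr_of \<sigma> ''side'' = (\<lambda>_. 0))
     (Store ''side'' (Const 0) (Const 1)) 1 (colour_inv 0)"
  proof (rule hoare_run)
    fix \<sigma> assume \<sigma>: "initial \<sigma> \<and> untouched_sizes \<sigma> \<and> arr_of \<sigma> ''side'' = (\<lambda>_. 0)"
    have "coloured ((\<lambda>_. 0)(0 := 1)) {0}"
      using zero_X n_pos by (auto simp: coloured_def side_def)
    moreover have "min n (Suc 0) \<le> card {0::nat}" by simp
    ultimately show "colour_inv 0 (run (Store ''side'' (Const 0) (Const 1)) \<sigma>)"
      using \<sigma> unfolding colour_inv_def by (auto simp: initial_def untouched_sizes_def)
  qed simp_all
  moreover have "hoare (colour_inv 0) (For ''r'' (For ''v'' colour_body)) (n * ((n * 6 + 2) + 2) + 2)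
      (colour_inv n)"
  proof (rule hoare_For)
    fix r
    show "hoare (\<lambda>\<sigma>. colour_inv r \<sigma> \<and> nat_of \<sigma> ''r'' = r) (For ''v'' colour_body) (n * 6 + 2)
        (colour_inv (Suc r))"
      by (rule hoare_conseq[OF hoare_colour_round]) auto
  qed (auto simp: colour_inv_def initial_def untouched_sizes_def For_def colour_body_def Let_def)
  ultimately have "hoare (\<lambda>\<sigma>. initial \<sigma> \<and> untouched_sizes \<sigma> \<and> arr_of \<sigma> ''side'' = (\<lambda>_. 0))
     colour (1 + (n * ((n * 6 + 2) + 2) + 2)) (colour_inv n)"
    unfolding colour_def by (rule hoare_Seq)
  then show ?thesis
  proof (rule hoare_conseq)
    fix \<sigma> assume "colour_inv n \<sigma>"
    then obtain C where C: "coloured (arr_of \<sigma> ''side'') C" "n \<le> card C"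
      and \<sigma>: "initial \<sigma>" "untouched_sizes \<sigma>" by (auto simp: colour_inv_def)
    have "C = {0..<n}" using C by (intro card_seteq) (auto simp: coloured_def)
    then show "initial \<sigma> \<and> untouched_sizes \<sigma> \<and> sides_known \<sigma>"
      using C \<sigma> by (auto simp: coloured_def sides_known_def)
  qed (auto simp: algebra_simps)
qed

section \<open>Greedy load sizes\<close>

definition loads :: "nat \<Rightarrow> nat \<Rightarrow> nat \<Rightarrow> nat \<Rightarrow> nat" where
  "loads a b c = (\<lambda>_. 0)(1 := a, 2 := b, 3 := c)"

lemma loads_simps [simp]: "loads a b c (Suc 0) = a" "loads a b c 2 = b" "loads a b c 3 = c"
  by (auto simp: loads_def)

lemma loads_upd [simp]:
  "(loads a b c)(Suc 0 := a') = loads a' b c" "(loads a b c)(2 := b') = loads a b' c"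
  "(loads a b c)(3 := c') = loads a b c'"
  by (auto simp: loads_def)

definition good_sizes :: "nat \<Rightarrow> nat \<Rightarrow> nat \<Rightarrow> nat \<Rightarrow> bool" where
  "good_sizes r a b c \<longleftrightarrow> a + b + c = r \<and> 2 * a \<le> n \<and> b \<le> a \<and> c \<le> b \<and>
     optimal_sizes r (loads a b c)"

text \<open>The comparison of \<open>least_loaded\<close> with denominators cleared, in the negated
  form in which \<open>test_load\<close> evaluates it.\<close>

definition no_worse :: "nat \<Rightarrow> nat \<Rightarrow> nat \<Rightarrow> nat \<Rightarrow> bool" where
  "no_worse x i y j \<longleftrightarrow> \<not> (2 * y < n \<and> real (y + 1) * s i < real (x + 1) * s j)"

lemma no_worse_iff:
  assumes "i \<in> machines" "j \<in> machines"
  shows "no_worse x i y j \<longleftrightarrow> (2 * y < n \<longrightarrow> real (x + 1) / s i \<le> real (y + 1) / s j)"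
  using s_pos[OF assms(1)] s_pos[OF assms(2)] by (auto simp: no_worse_def divide_simps not_less)

lemma least_loaded_loads:
  "least_loaded (loads a b c) 1 \<longleftrightarrow> 2 * a < n \<and> no_worse a 1 b 2 \<and> no_worse a 1 c 3"
  "least_loaded (loads a b c) 2 \<longleftrightarrow> 2 * b < n \<and> no_worse b 2 a 1 \<and> no_worse b 2 c 3"
  unfolding least_loaded_def machines_ball by (auto simp: no_worse_iff machines_def)

lemma good_sizes_step:
  assumes g: "good_sizes r a b c" and "r < n"
  shows "least_loaded (loads a b c) 1 \<Longrightarrow> good_sizes (Suc r) (Suc a) b c"
    and "\<not> least_loaded (loads a b c) 1 \<Longrightarrow> least_loaded (loads a b c) 2 \<Longrightarrow>
      good_sizes (Suc r) a (Suc b) c"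
    and "\<not> least_loaded (loads a b c) 1 \<Longrightarrow> \<not> least_loaded (loads a b c) 2 \<Longrightarrow>
      good_sizes (Suc r) a b (Suc c)"
proof -
  let ?x = "loads a b c"
  have sum: "?x 1 + ?x 2 + ?x 3 = r" and opt: "optimal_sizes r ?x"
    using g by (auto simp: good_sizes_def)
  note step = optimal_sizes_step[OF opt sum]
  have mach: "1 \<in> machines" "2 \<in> machines" "3 \<in> machines" by (auto simp: machines_def)
  show "good_sizes (Suc r) (Suc a) b c" if "least_loaded ?x 1"
  proof -
    have "2 * a < n" using that by (simp add: least_loaded_def)
    \<comment> \<open>As \<open>n = 2 * m\<close> is even, \<open>2 * a < n\<close> leaves room for
      a whole job.\<close>
    then have "2 * Suc a \<le> n" using n_eq by presburger
    then show ?thesis using g step[OF mach(1) that] by (auto simp: good_sizes_def)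
  qed
  show "good_sizes (Suc r) a (Suc b) c" if "\<not> least_loaded ?x 1" "least_loaded ?x 2"
  proof -
    \<comment> \<open>With equal sizes machine 1 would have qualified too; hence adding a job keeps
      the sizes sorted.\<close>
    have "a \<noteq> b" using least_loaded_le[OF mach(1,2) that(2)] that(1) s12 by auto
    then show ?thesis using g step[OF mach(2) that(2)] by (auto simp: good_sizes_def)
  qed
  show "good_sizes (Suc r) a b (Suc c)" if "\<not> least_loaded ?x 1" "\<not> least_loaded ?x 2"
  proof -
    have l: "least_loaded ?x 3"
      using ex_least_loaded[of ?x] sum \<open>r < n\<close> that unfolding machines_bex by auto
    have "b \<noteq> c" using least_loaded_le[OF mach(2,3) l] that(2) s23 by auto
    then show ?thesis using g step[OF mach(3) l] by (auto simp: good_sizes_def)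
  qed
qed

definition products :: "nat \<Rightarrow> nat \<Rightarrow> nat \<Rightarrow> state \<Rightarrow> bool" where
  "products a b c \<sigma> \<longleftrightarrow> nat_of \<sigma> ''x1'' = a \<and> nat_of \<sigma> ''x2'' = b \<and> nat_of \<sigma> ''x3'' = c \<and>
     real_of \<sigma> ''s1'' = s 1 \<and> real_of \<sigma> ''s2'' = s 2 \<and> real_of \<sigma> ''s3'' = s 3 \<and>
     real_of \<sigma> ''p12'' = real (a + 1) * s 2 \<and> real_of \<sigma> ''p13'' = real (a + 1) * s 3 \<and>
     real_of \<sigma> ''p21'' = real (b + 1) * s 1 \<and> real_of \<sigma> ''p23'' = real (b + 1) * s 3 \<and>
     real_of \<sigma> ''p31'' = real (c + 1) * s 1 \<and> real_of \<sigma> ''p32'' = real (c + 1) * s 2"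

definition sizes_inv :: "nat \<Rightarrow> state \<Rightarrow> bool" where
  "sizes_inv r \<sigma> \<longleftrightarrow> initial \<sigma> \<and> sides_known \<sigma> \<and> (\<exists>a b c. good_sizes r a b c \<and> products a b c \<sigma>)"

lemma hoare_sizes_body:
  assumes "r < n"
  shows "hoare (sizes_inv r) sizes_body 5 (sizes_inv (Suc r))"
proof (rule hoare_run)
  fix \<sigma> assume "sizes_inv r \<sigma>"
  then obtain a b c where \<sigma>: "initial \<sigma>" "sides_known \<sigma>" and g: "good_sizes r a b c"
    and p: "products a b c \<sigma>" by (auto simp: sizes_inv_def)
  have n: "nat_of \<sigma> ''n'' = n" using \<sigma> by (simp add: initial_def)
  let ?\<tau> = "run sizes_body \<sigma>"
  have test1: "bval (test_load ''x1'' ''x2'' ''p12'' ''p21'' ''x3'' ''p13'' ''p31'') \<sigma> \<longleftrightarrow>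
      least_loaded (loads a b c) 1"
    using p n unfolding least_loaded_loads(1)
    by (simp add: test_load_def products_def no_worse_def flip: mult_2)
  have test2: "bval (test_load ''x2'' ''x1'' ''p21'' ''p12'' ''x3'' ''p23'' ''p32'') \<sigma> \<longleftrightarrow>
      least_loaded (loads a b c) 2"
    using p n unfolding least_loaded_loads(2)
    by (simp add: test_load_def products_def no_worse_def flip: mult_2)
  have "initial ?\<tau>" using \<sigma>(1) by (auto simp: sizes_body_def add_load_def initial_def)
  moreover have "sides_known ?\<tau>"
    using \<sigma>(2) by (auto simp: sizes_body_def add_load_def sides_known_def)
  moreover have "\<exists>a b c. good_sizes (Suc r) a b c \<and> products a b c ?\<tau>"
  proof (cases "least_loaded (loads a b c) 1")
    case True
    then have "products (Suc a) b c ?\<tau>"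
      using p test1 by (auto simp: sizes_body_def add_load_def products_def algebra_simps)
    then show ?thesis using good_sizes_step(1)[OF g assms True] by blast
  next
    case 1: False
    show ?thesis
    proof (cases "least_loaded (loads a b c) 2")
      case True
      then have "products a (Suc b) c ?\<tau>"
        using p test1 test2 1 by (auto simp: sizes_body_def add_load_def products_def algebra_simps)
      then show ?thesis using good_sizes_step(2)[OF g assms 1 True] by blast
    next
      case False
      then have "products a b (Suc c) ?\<tau>"
        using p test1 test2 1 by (auto simp: sizes_body_def add_load_def products_def algebra_simps)
      then show ?thesis using good_sizes_step(3)[OF g assms 1 False] by blast
    qed
  qed
  ultimately show "sizes_inv (Suc r) ?\<tau>" by (simp add: sizes_inv_def)
qed (simp_all add: sizes_body_def add_load_def)

definition sized :: "nat \<Rightarrow> nat \<Rightarrow> nat \<Rightarrow> state \<Rightarrow> bool" where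
  "sized a b c \<sigma> \<longleftrightarrow> nat_of \<sigma> ''x1'' = a \<and> nat_of \<sigma> ''x2'' = b \<and> nat_of \<sigma> ''x3'' = c"

lemma hoare_sizes:
  "hoare (\<lambda>\<sigma>. initial \<sigma> \<and> untouched_sizes \<sigma> \<and> sides_known \<sigma>) sizes (n * 7 + 8)
     (\<lambda>\<sigma>. \<exists>a b c. good_sizes n a b c \<and> initial \<sigma> \<and> sides_known \<sigma> \<and> sized a b c \<sigma>)"
proof -
  have "hoare (sizes_inv 0) (For ''r'' sizes_body) (n * (5 + 2) + 2) (sizes_inv n)"
  proof (rule hoare_For)
    fix r assume "r < n"
    then show "hoare (\<lambda>\<sigma>. sizes_inv r \<sigma> \<and> nat_of \<sigma> ''r'' = r) sizes_body 5 (sizes_inv (Suc r))"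
      by (rule hoare_conseq[OF hoare_sizes_body]) auto
  qed (auto simp: sizes_inv_def initial_def sides_known_def products_def sizes_body_def add_load_def)
  moreover have "good_sizes 0 0 0 0"
    using optimal_sizes_0 by (simp add: good_sizes_def loads_def fun_upd_idem)
  ultimately have "hoare (\<lambda>\<sigma>. initial \<sigma> \<and> untouched_sizes \<sigma> \<and> sides_known \<sigma>) sizes
      (6 + (n * (5 + 2) + 2)) (sizes_inv n)"
    unfolding sizes_def
    by (intro hoare_Seq[OF hoare_run])
      (auto simp: sizes_inv_def initial_def sides_known_def products_def untouched_sizes_def)
  then show ?thesis
    by (rule hoare_conseq) (auto simp: sizes_inv_def products_def sized_def)
qed

section \<open>The selected set and its neighbour counts\<close>

lemma adj_distinct:
  assumes "v < n"
  shows "A (v + v + v) \<noteq> A (v + v + Suc v)" "A (v + v + v) \<noteq> A (v + v + Suc (Suc v))"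
    "A (v + v + Suc v) \<noteq> A (v + v + Suc (Suc v))"
  using card_nb[OF assms] nb_adj[OF assms] by (auto simp: card_insert_if split: if_splits)

definition steady :: "nat \<Rightarrow> nat \<Rightarrow> nat \<Rightarrow> state \<Rightarrow> bool" where
  "steady a b c \<sigma> \<longleftrightarrow> nat_of \<sigma> ''n'' = n \<and> arr_of \<sigma> ''adj'' = A \<and>
     arr_of \<sigma> ''machine'' = (\<lambda>_. 0) \<and> nat_of \<sigma> ''q'' = 0 \<and> sides_known \<sigma> \<and> sized a b c \<sigma>"

definition selected :: "nat set \<Rightarrow> state \<Rightarrow> bool" where
  "selected S \<sigma> \<longleftrightarrow> S \<subseteq> X \<and> (\<forall>v<n. arr_of \<sigma> ''sel'' v = of_bool (v \<in> S)) \<and>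
     (\<forall>w<n. arr_of \<sigma> ''cnt'' w = card (nb w \<inter> S)) \<and> nat_of \<sigma> ''z'' = card S"

definition flip :: "nat \<Rightarrow> nat set \<Rightarrow> nat set" where
  "flip x S = (if x \<in> S then S - {x} else insert x S)"

lemma finite_sub_X: "S \<subseteq> X \<Longrightarrow> finite S"
  using finite_subset finite_X by blast

text \<open>The form of the right-hand side mirrors \<open>shifted\<close>. Truncation does no harm:
  \<open>x \<in> S\<close> and \<open>w \<in> nb x\<close> make the old count positive.\<close>

lemma card_nb_Int_flip:
  assumes "S \<subseteq> X" "x \<in> X" "w < n"
  shows "card (nb w \<inter> flip x S) =
    (if w \<in> nb x then card (nb w \<inter> S) + 1 - 2 * of_bool (x \<in> S) else card (nb w \<inter> S))"
proof (cases "w \<in> nb x")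
  case True
  then have x: "x \<in> nb w" using nb_sym assms X_less by blast
  have fin: "finite (nb w \<inter> S)" using finite_sub_X[OF assms(1)] by blast
  show ?thesis
  proof (cases "x \<in> S")
    case True
    have "nb w \<inter> flip x S = (nb w \<inter> S) - {x}" using True by (auto simp: flip_def)
    moreover have "x \<in> nb w \<inter> S" using True x by blast
    ultimately show ?thesis using fin \<open>w \<in> nb x\<close> True by (simp add: card_Diff_singleton)
  next
    case False
    have "nb w \<inter> flip x S = insert x (nb w \<inter> S)" using False x by (auto simp: flip_def)
    then show ?thesis using fin \<open>w \<in> nb x\<close> False by simp
  qed
next
  case False
  then have "x \<notin> nb w" using nb_sym assms X_less by blast
  then have "nb w \<inter> flip x S = nb w \<inter> S" by (auto simp: flip_def)
  then show ?thesis using False by simp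
qed

lemma card_flip:
  assumes "S \<subseteq> X"
  shows "card (flip x S) = card S + 1 - 2 * of_bool (x \<in> S)"
  using finite_sub_X[OF assms] by (auto simp: flip_def)

text \<open>\<open>sel\<close> is flipped last because the other updates read its old value; the
  three cells of \<open>cnt\<close> are distinct, so each changes exactly once.\<close>

lemma hoare_toggle:
  assumes x: "x \<in> X"
  shows "hoare (\<lambda>\<sigma>. steady a b c \<sigma> \<and> selected S \<sigma> \<and> nat_of \<sigma> ''u'' = x) toggle 5
    (\<lambda>\<sigma>. steady a b c \<sigma> \<and> selected (flip x S) \<sigma>)"
proof (rule hoare_run)
  fix \<sigma> assume \<sigma>: "steady a b c \<sigma> \<and> selected S \<sigma> \<and> nat_of \<sigma> ''u'' = x"
  have xn: "x < n" using x X_less by simp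
  have adj: "arr_of \<sigma> ''adj'' = A" and S: "S \<subseteq> X" and u: "nat_of \<sigma> ''u'' = x"
    and sel: "arr_of \<sigma> ''sel'' x = of_bool (x \<in> S)"
    using \<sigma> xn by (auto simp: steady_def selected_def)
  let ?\<tau> = "run toggle \<sigma>" and ?f = "arr_of \<sigma> ''cnt''"
  have "steady a b c ?\<tau>"
    using \<sigma> by (auto simp: toggle_def steady_def sides_known_def sized_def)
  moreover have "arr_of ?\<tau> ''cnt'' w = card (nb w \<inter> flip x S)" if "w < n" for w
  proof -
    have "arr_of ?\<tau> ''cnt'' w = (if w \<in> nb x then ?f w + 1 - 2 * of_bool (x \<in> S) else ?f w)"
      using adj u sel adj_distinct[OF xn] by (simp add: toggle_def nb_adj[OF xn])
    then show ?thesis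
      using \<sigma> card_nb_Int_flip[OF S x that] that by (simp add: selected_def)
  qed
  moreover have "arr_of ?\<tau> ''sel'' v = of_bool (v \<in> flip x S)" if "v < n" for v
    using \<sigma> that u sel by (auto simp: toggle_def selected_def flip_def)
  moreover have "nat_of ?\<tau> ''z'' = card (flip x S)"
    using \<sigma> u sel card_flip[OF S] by (simp add: toggle_def selected_def)
  moreover have "flip x S \<subseteq> X" using S x by (auto simp: flip_def)
  ultimately show "steady a b c ?\<tau> \<and> selected (flip x S) ?\<tau>" by (simp add: selected_def)
qed (simp_all add: toggle_def)

text \<open>The value of \<open>Score\<close> at any vertex. On \<open>X\<close> it agrees with
  \<open>score\<close>; on \<open>Y\<close> the term with factor 4 disqualifies the vertex whatever
  its value.\<close>

definition raw_score :: "nat set \<Rightarrow> nat \<Rightarrow> nat" where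
  "raw_score S v = card {y \<in> nb v. card (nb y \<inter> S) = of_bool (v \<in> S)}"

lemma raw_score_eq:
  assumes "S \<subseteq> X" "v \<in> X"
  shows "raw_score S v = score S v"
proof -
  have v: "v < n" using assms X_less by simp
  have "card (nb y \<inter> S) = of_bool (v \<in> S) \<longleftrightarrow> y \<notin> nbs (S - {v})" if y: "y \<in> nb v" for y
  proof -
    have fin: "finite (nb y \<inter> S)" using finite_sub_X[OF assms(1)] by blast
    have "v \<in> nb y" using y v nb_sym by blast
    then have "card (nb y \<inter> S) = card (nb y \<inter> S - {v}) + of_bool (v \<in> S)"
      using fin card_Suc_Diff1[OF fin, of v] by auto
    then have "card (nb y \<inter> S) = of_bool (v \<in> S) \<longleftrightarrow> nb y \<inter> S - {v} = {}"
      using fin by simp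
    also have "\<dots> \<longleftrightarrow> (\<forall>u\<in>S - {v}. y \<notin> nb u)"
      using nb_sym_iff[of y] nb_less[OF v y] assms(1) X_less by blast
    also have "\<dots> \<longleftrightarrow> y \<notin> nbs (S - {v})" by (simp add: nbs_def)
    finally show ?thesis .
  qed
  then have "{y \<in> nb v. card (nb y \<inter> S) = of_bool (v \<in> S)} = nb v - nbs (S - {v})" by blast
  then show ?thesis by (simp add: raw_score_def score_def)
qed

lemma nval_Eq [simp]: "nval (Eq e f) \<sigma> = of_bool (nval e \<sigma> = nval f \<sigma>)"
  by (simp add: Eq_def)

lemma nval_times4 [simp]: "nval (times4 e) \<sigma> = 4 * nval e \<sigma>"
  by (simp add: times4_def)

lemma nval_Score:
  assumes "steady a b c \<sigma>" "selected S \<sigma>" "nat_of \<sigma> ''v'' < n"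
  shows "nval Score \<sigma> = raw_score S (nat_of \<sigma> ''v'')"
proof -
  let ?v = "nat_of \<sigma> ''v''"
  let ?P = "\<lambda>y. card (nb y \<inter> S) = of_bool (?v \<in> S)"
  let ?x = "A (?v + ?v + ?v)" and ?y = "A (?v + ?v + Suc ?v)" and ?z = "A (?v + ?v + Suc (Suc ?v))"
  have nb: "nb ?v = {?x, ?y, ?z}" using nb_adj[OF assms(3)] .
  then have less: "?x < n" "?y < n" "?z < n" using nb_less[OF assms(3)] by auto
  have "raw_score S ?v = (\<Sum>y\<in>nb ?v. of_bool (?P y))"
    using finite_nb[OF assms(3)] by (simp add: raw_score_def Int_def)
  also have "\<dots> = of_bool (?P ?x) + (of_bool (?P ?y) + of_bool (?P ?z))"
    unfolding nb using adj_distinct[OF assms(3)] by (simp del: of_bool_eq_iff)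
  also have "\<dots> = nval Score \<sigma>"
    using assms less by (simp add: Score_def steady_def selected_def)
  finally show ?thesis by simp
qed

lemma raw_score_le: "v < n \<Longrightarrow> raw_score S v \<le> 3"
  unfolding raw_score_def using card_nb card_mono[OF finite_nb, of v "{y \<in> nb v. _ y}"] by simp

lemma hoare_scan_grow:
  assumes "S \<subset> X"
  shows "hoare (\<lambda>\<sigma>. steady a b c \<sigma> \<and> selected S \<sigma>) (scan grow_key) (n * 5 + 3)
    (\<lambda>\<sigma>. \<exists>x\<in>X - S. (\<forall>v\<in>X - S. score S x \<le> score S v) \<and>
       steady a b c \<sigma> \<and> selected S \<sigma> \<and> nat_of \<sigma> ''u'' = x)"
proof -
  let ?\<kappa> = "\<lambda>v. raw_score S v + 4 * (side v - 1 + of_bool (v \<in> S))"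
  obtain w where w: "w \<in> X - S" using assms by blast
  have val: "?\<kappa> v = score S v" if "v \<in> X - S" for v
    using that assms raw_score_eq[of S v] by (auto simp: side_def)
  have small: "?\<kappa> v < 4 \<longleftrightarrow> v \<in> X - S" if "v < n" for v
    using raw_score_le[OF that, of S] by (auto simp: side_def)
  have "hoare (\<lambda>\<sigma>. steady a b c \<sigma> \<and> selected S \<sigma>) (scan grow_key) (n * 5 + 3)
    (\<lambda>\<sigma>. (steady a b c \<sigma> \<and> selected S \<sigma>) \<and> nat_of \<sigma> ''u'' < n \<and>
      (\<forall>v<n. ?\<kappa> (nat_of \<sigma> ''u'') \<le> ?\<kappa> v))"
  proof (rule hoare_scan)
    show "\<exists>v<n. ?\<kappa> v < 4" using small w X_less by blast
  next
    fix \<sigma> assume \<sigma>: "steady a b c \<sigma> \<and> selected S \<sigma>" "nat_of \<sigma> ''v'' < n"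
    then have "nval (At ''side'' ''v'') \<sigma> = side (nat_of \<sigma> ''v'')"
      "nval (At ''sel'' ''v'') \<sigma> = of_bool (nat_of \<sigma> ''v'' \<in> S)"
      by (auto simp: steady_def selected_def sides_known_def)
    then show "nval grow_key \<sigma> = ?\<kappa> (nat_of \<sigma> ''v'')"
      using nval_Score[OF conjunct1 conjunct2, OF \<sigma>(1,1,2)] unfolding grow_key_def by simp
  qed (auto simp: steady_def selected_def sides_known_def sized_def)
  then show ?thesis
  proof (rule hoare_conseq)
    fix \<sigma> assume \<sigma>: "(steady a b c \<sigma> \<and> selected S \<sigma>) \<and> nat_of \<sigma> ''u'' < n \<and>
      (\<forall>v<n. ?\<kappa> (nat_of \<sigma> ''u'') \<le> ?\<kappa> v)"
    let ?u = "nat_of \<sigma> ''u''"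
    have "?\<kappa> ?u < 4" using \<sigma> small[of w] w X_less[of w] by (meson DiffD1 order.strict_trans1)
    then have u: "?u \<in> X - S" using small \<sigma> by blast
    have "score S ?u \<le> score S v" if "v \<in> X - S" for v
      using \<sigma> val[OF u] val[OF that] that X_less[of v] by (metis DiffD1)
    then show "\<exists>x\<in>X - S. (\<forall>v\<in>X - S. score S x \<le> score S v) \<and>
       steady a b c \<sigma> \<and> selected S \<sigma> \<and> nat_of \<sigma> ''u'' = x" using u \<sigma> by blast
  qed simp_all
qed

lemma hoare_scan_shrink:
  assumes "S \<subseteq> X" "S \<noteq> {}"
  shows "hoare (\<lambda>\<sigma>. steady a b c \<sigma> \<and> selected S \<sigma>) (scan shrink_key) (n * 5 + 3)
    (\<lambda>\<sigma>. \<exists>x\<in>S. (\<forall>v\<in>S. score S v \<le> score S x) \<and>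
       steady a b c \<sigma> \<and> selected S \<sigma> \<and> nat_of \<sigma> ''u'' = x)"
proof -
  let ?\<kappa> = "\<lambda>v. (3 - raw_score S v) + 4 * (1 - of_bool (v \<in> S))"
  obtain w where w: "w \<in> S" using assms by blast
  have less: "v < n" if "v \<in> S" for v using that assms X_less by blast
  have val: "?\<kappa> v = 3 - score S v" if "v \<in> S" for v
    using that assms raw_score_eq[of S v] by auto
  have small: "?\<kappa> v < 4 \<longleftrightarrow> v \<in> S" for v by auto
  have "hoare (\<lambda>\<sigma>. steady a b c \<sigma> \<and> selected S \<sigma>) (scan shrink_key) (n * 5 + 3)
    (\<lambda>\<sigma>. (steady a b c \<sigma> \<and> selected S \<sigma>) \<and> nat_of \<sigma> ''u'' < n \<and>
      (\<forall>v<n. ?\<kappa> (nat_of \<sigma> ''u'') \<le> ?\<kappa> v))"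
  proof (rule hoare_scan)
    show "\<exists>v<n. ?\<kappa> v < 4" using small w less by blast
  next
    fix \<sigma> assume \<sigma>: "steady a b c \<sigma> \<and> selected S \<sigma>" "nat_of \<sigma> ''v'' < n"
    then have "nval (At ''sel'' ''v'') \<sigma> = of_bool (nat_of \<sigma> ''v'' \<in> S)"
      by (auto simp: selected_def)
    then show "nval shrink_key \<sigma> = ?\<kappa> (nat_of \<sigma> ''v'')"
      using nval_Score[OF conjunct1 conjunct2, OF \<sigma>(1,1,2)] unfolding shrink_key_def by simp
  qed (auto simp: steady_def selected_def sides_known_def sized_def)
  then show ?thesis
  proof (rule hoare_conseq)
    fix \<sigma> assume \<sigma>: "(steady a b c \<sigma> \<and> selected S \<sigma>) \<and> nat_of \<sigma> ''u'' < n \<and>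
      (\<forall>v<n. ?\<kappa> (nat_of \<sigma> ''u'') \<le> ?\<kappa> v)"
    let ?u = "nat_of \<sigma> ''u''"
    have "?\<kappa> ?u < 4" using \<sigma> small[of w] w less[of w] by (meson order.strict_trans1)
    then have u: "?u \<in> S" using small by blast
    have "score S v \<le> score S ?u" if "v \<in> S" for v
    proof -
      \<comment> \<open>Scores are at most 3, so the truncated difference faithfully reverses their
        order.\<close>
      have "3 - score S ?u \<le> 3 - score S v"
        using \<sigma> val[OF u] val[OF that] less[OF that] by metis
      then show ?thesis using score_le[OF less[OF that], of S] score_le[OF less[OF u], of S] by linarith
    qed
    then show "\<exists>x\<in>S. (\<forall>v\<in>S. score S v \<le> score S x) \<and>
       steady a b c \<sigma> \<and> selected S \<sigma> \<and> nat_of \<sigma> ''u'' = x" using u \<sigma> by blast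
  qed simp_all
qed

lemma hoare_seed:
  "hoare (\<lambda>\<sigma>. initial \<sigma> \<and> sides_known \<sigma> \<and> sized a b c \<sigma>) seed 19
     (\<lambda>\<sigma>. steady a b c \<sigma> \<and> (\<exists>y\<in>Y. selected (nb y) \<sigma>))"
proof -
  let ?y = "A 0"
  let ?p = "A (?y + ?y + ?y)" and ?q = "A (?y + ?y + Suc ?y)" and ?r = "A (?y + ?y + Suc (Suc ?y))"
  have y: "?y \<in> Y" using nb_adj[OF n_pos] nb_X[OF zero_X] by auto
  then have yn: "?y < n" using Y_less by simp
  note dist = adj_distinct[OF yn]
  have nb: "nb ?y = {?p, ?q, ?r}" using nb_adj[OF yn] .
  then have X: "?p \<in> X" "?q \<in> X" "?r \<in> X" using nb_Y[OF y] by auto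
  let ?I = "\<lambda>S \<sigma>. (steady a b c \<sigma> \<and> selected S \<sigma>) \<and> nat_of \<sigma> ''y'' = ?y"
  have step: "hoare (?I S) (Seq (Assign ''u'' (Nbr j ''y'')) toggle) 6 (?I (flip x S))"
    if "x = A (?y + ?y + (?y + j))" "x \<in> X" for x j S
  proof -
    have "hoare (?I S) (Assign ''u'' (Nbr j ''y'')) 1
      (\<lambda>\<sigma>. (steady a b c \<sigma> \<and> selected S \<sigma> \<and> nat_of \<sigma> ''u'' = x) \<and> nat_of \<sigma> ''y'' = ?y)"
      using that(1)
      by (intro hoare_run) (auto simp: steady_def selected_def sides_known_def sized_def)
    moreover have "hoare (\<lambda>\<sigma>. (steady a b c \<sigma> \<and> selected S \<sigma> \<and> nat_of \<sigma> ''u'' = x) \<and> nat_of \<sigma> ''y'' = ?y)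
      toggle 5 (?I (flip x S))"
      by (rule hoare_frame[OF hoare_toggle[OF that(2)]]) (simp add: toggle_def)
    ultimately have "hoare (?I S) (Seq (Assign ''u'' (Nbr j ''y'')) toggle) (1 + 5) (?I (flip x S))"
      by (rule hoare_Seq)
    then show ?thesis by simp
  qed
  have "hoare (\<lambda>\<sigma>. initial \<sigma> \<and> sides_known \<sigma> \<and> sized a b c \<sigma>) (Assign ''y'' (Elem ''adj'' (Const 0))) 1
      (?I {})"
    by (intro hoare_run)
      (auto simp: initial_def steady_def selected_def sides_known_def sized_def)
  then have "hoare (\<lambda>\<sigma>. initial \<sigma> \<and> sides_known \<sigma> \<and> sized a b c \<sigma>) seed (1 + (6 + (6 + 6)))
      (?I (flip ?r (flip ?q (flip ?p {}))))"
    unfolding seed_def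
    by (rule hoare_Seq[OF _ hoare_Seq[OF step[OF _ X(1)]
          hoare_Seq[OF step[OF _ X(2)] step[OF _ X(3)]]]]) simp_all
  moreover have "flip ?r (flip ?q (flip ?p {})) = nb ?y"
    using dist unfolding nb by (auto simp: flip_def)
  ultimately show ?thesis using y by (elim hoare_conseq) auto
qed

section \<open>The growing and shrinking loops\<close>

context
  fixes a b c k :: nat
  assumes good: "good_sizes n a b c" and k: "k = m - a"
begin

lemma sizes_facts: "a + b + c = 2 * m" "a \<le> m" "b \<le> m" "a + k = m" "3 * k \<le> m" "m + k \<le> 2 * b"
  using good n_eq unfolding good_sizes_def k by linarith+

text \<open>The \<open>max 3\<close> accounts for \<open>k \<le> 1\<close>, where the seed already
  exceeds the target.\<close>

definition grow_inv :: "state \<Rightarrow> bool" where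
  "grow_inv \<sigma> \<longleftrightarrow> (\<exists>S. steady a b c \<sigma> \<and> selected S \<sigma> \<and> grown k S \<and> card S \<le> max 3 (k + 1))"

definition shrink_inv :: "state \<Rightarrow> bool" where
  "shrink_inv \<sigma> \<longleftrightarrow> (\<exists>S. steady a b c \<sigma> \<and> selected S \<sigma> \<and> shrunk k b S)"

lemma z_le: "selected S \<sigma> \<Longrightarrow> nat_of \<sigma> ''z'' = card S \<and> card S \<le> n"
  using card_mono[of "{0..<n}" S] verts by (auto simp: selected_def)

lemma hoare_grow: "hoare grow_inv grow (n * (n * 5 + 9) + 1) shrink_inv"
proof -
  let ?b = "NLess (Add (Add (Var ''z'') (Var ''z'')) (Var ''x1''))
      (Add (Add (Var ''x2'') (Var ''x3'')) (Const 2))"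
  \<comment> \<open>As \<open>b + c = a + 2 * k\<close>, the test amounts to
    \<open>2 * card S < 2 * k + 2\<close>.\<close>
  have b: "bval ?b \<sigma> \<longleftrightarrow> card S \<le> k" if "steady a b c \<sigma>" "selected S \<sigma>" for \<sigma> S
    using that sizes_facts by (auto simp: steady_def sized_def selected_def)
  have "hoare (\<lambda>\<sigma>. grow_inv \<sigma> \<and> n - nat_of \<sigma> ''z'' \<le> n) grow (n * ((n * 5 + 3 + 5) + 1) + 1)
    (\<lambda>\<sigma>. grow_inv \<sigma> \<and> \<not> bval ?b \<sigma>)"
    unfolding grow_def
  proof (rule hoare_Loop)
    fix j
    have "hoare (\<lambda>\<sigma>. \<exists>S. (steady a b c \<sigma> \<and> selected S \<sigma>) \<and>
        (grown k S \<and> card S \<le> max 3 (k + 1) \<and> card S \<le> k \<and> n - card S = j))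
      (Seq (scan grow_key) toggle) (n * 5 + 3 + 5) (\<lambda>\<sigma>. grow_inv \<sigma> \<and> n - nat_of \<sigma> ''z'' < j)"
    proof (rule hoare_ex)
      fix S
      let ?P = "grown k S \<and> card S \<le> max 3 (k + 1) \<and> card S \<le> k \<and> n - card S = j"
      show "hoare (\<lambda>\<sigma>. (steady a b c \<sigma> \<and> selected S \<sigma>) \<and> ?P)
        (Seq (scan grow_key) toggle) (n * 5 + 3 + 5) (\<lambda>\<sigma>. grow_inv \<sigma> \<and> n - nat_of \<sigma> ''z'' < j)"
      proof (cases ?P)
        case True
        have S: "S \<subseteq> X" using True by (simp add: grown_def)
        have "card S < m" using True sizes_facts m_ge_4 by linarith
        then have sub: "S \<subset> X" using S by auto
        have "hoare (\<lambda>\<sigma>. steady a b c \<sigma> \<and> selected S \<sigma>)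
          (Seq (scan grow_key) toggle) (n * 5 + 3 + 5) (\<lambda>\<sigma>. grow_inv \<sigma> \<and> n - nat_of \<sigma> ''z'' < j)"
        proof (rule hoare_Seq[OF hoare_scan_grow[OF sub]], unfold Bex_def, rule hoare_ex)
          fix x
          show "hoare (\<lambda>\<sigma>. x \<in> X - S \<and> (\<forall>v\<in>X - S. score S x \<le> score S v) \<and>
              steady a b c \<sigma> \<and> selected S \<sigma> \<and> nat_of \<sigma> ''u'' = x) toggle 5
            (\<lambda>\<sigma>. grow_inv \<sigma> \<and> n - nat_of \<sigma> ''z'' < j)"
          proof (cases "x \<in> X - S \<and> (\<forall>v\<in>X - S. score S x \<le> score S v)")
            case x: True
            have g: "grown k (insert x S)"
              using x True sizes_facts by (intro grown_insert) auto
            have fl: "flip x S = insert x S" and cd: "card (insert x S) = card S + 1"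
              using x finite_sub_X[OF S] by (auto simp: flip_def)
            have "hoare (\<lambda>\<sigma>. steady a b c \<sigma> \<and> selected S \<sigma> \<and> nat_of \<sigma> ''u'' = x) toggle 5
              (\<lambda>\<sigma>. steady a b c \<sigma> \<and> selected (insert x S) \<sigma>)"
              using hoare_toggle[of x a b c S] x unfolding fl by blast
            then show ?thesis
            proof (rule hoare_conseq)
              fix \<sigma> assume \<sigma>: "steady a b c \<sigma> \<and> selected (insert x S) \<sigma>"
              moreover have "card (insert x S) \<le> max 3 (k + 1)" using cd True by linarith
              ultimately have "grow_inv \<sigma>" unfolding grow_inv_def using g by blast
              moreover have "n - nat_of \<sigma> ''z'' < j"
                using z_le[of "insert x S" \<sigma>] \<sigma> cd True by linarith
              ultimately show "grow_inv \<sigma> \<and> n - nat_of \<sigma> ''z'' < j" by simp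
            qed auto
          next
            case False
            then show ?thesis unfolding hoare_def by blast
          qed
        qed
        then show ?thesis by (rule hoare_conseq) auto
      next
        case False
        then show ?thesis unfolding hoare_def by blast
      qed
    qed
    then show "hoare (\<lambda>\<sigma>. grow_inv \<sigma> \<and> bval ?b \<sigma> \<and> n - nat_of \<sigma> ''z'' = j)
      (Seq (scan grow_key) toggle) (n * 5 + 3 + 5) (\<lambda>\<sigma>. grow_inv \<sigma> \<and> n - nat_of \<sigma> ''z'' < j)"
      by (rule hoare_conseq) (use b z_le in \<open>auto simp only: grow_inv_def\<close>)
  qed
  then show ?thesis
  proof (rule hoare_conseq)
    fix \<sigma> assume "grow_inv \<sigma> \<and> \<not> bval ?b \<sigma>"
    then obtain S where S: "steady a b c \<sigma>" "selected S \<sigma>" "grown k S" "card S \<le> max 3 (k + 1)"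
      "k < card S" using b unfolding grow_inv_def by (meson not_le)
    \<comment> \<open>For \<open>k \<ge> 2\<close> the size is exactly \<open>k + 1\<close>;
      otherwise it is 3, within \<open>k + 3\<close>.\<close>
    then have "shrunk k b S" by (auto simp: shrunk_def grown_def)
    then show "shrink_inv \<sigma>" using S unfolding shrink_inv_def by blast
  qed (auto simp: algebra_simps)
qed

text \<open>For \<open>k \<ge> 2\<close> the invariant allows at most one round; for
  \<open>k \<le> 1\<close> seed vertices are discarded until \<open>k\<close> remain.\<close>

lemma hoare_shrink:
  "hoare shrink_inv shrink (n * (n * 5 + 9) + 1)
    (\<lambda>\<sigma>. \<exists>S. steady a b c \<sigma> \<and> selected S \<sigma> \<and> card S = k \<and> card (nbs S) \<le> b)"
proof -
  let ?b = "NLess (Add (Var ''x2'') (Var ''x3'')) (Add (Add (Var ''z'') (Var ''z'')) (Var ''x1''))"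
  have b: "bval ?b \<sigma> \<longleftrightarrow> k < card S" if "steady a b c \<sigma>" "selected S \<sigma>" for \<sigma> S
    using that sizes_facts by (auto simp: steady_def sized_def selected_def)
  have "hoare (\<lambda>\<sigma>. shrink_inv \<sigma> \<and> nat_of \<sigma> ''z'' \<le> n) shrink (n * ((n * 5 + 3 + 5) + 1) + 1)
    (\<lambda>\<sigma>. shrink_inv \<sigma> \<and> \<not> bval ?b \<sigma>)"
    unfolding shrink_def
  proof (rule hoare_Loop)
    fix j
    have "hoare (\<lambda>\<sigma>. \<exists>S. (steady a b c \<sigma> \<and> selected S \<sigma>) \<and> (shrunk k b S \<and> k < card S \<and> card S = j))
      (Seq (scan shrink_key) toggle) (n * 5 + 3 + 5) (\<lambda>\<sigma>. shrink_inv \<sigma> \<and> nat_of \<sigma> ''z'' < j)"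
    proof (rule hoare_ex)
      fix S
      let ?P = "shrunk k b S \<and> k < card S \<and> card S = j"
      show "hoare (\<lambda>\<sigma>. (steady a b c \<sigma> \<and> selected S \<sigma>) \<and> ?P)
        (Seq (scan shrink_key) toggle) (n * 5 + 3 + 5) (\<lambda>\<sigma>. shrink_inv \<sigma> \<and> nat_of \<sigma> ''z'' < j)"
      proof (cases ?P)
        case True
        have S: "S \<subseteq> X" "S \<noteq> {}" using True by (auto simp: shrunk_def)
        have "hoare (\<lambda>\<sigma>. steady a b c \<sigma> \<and> selected S \<sigma>)
          (Seq (scan shrink_key) toggle) (n * 5 + 3 + 5) (\<lambda>\<sigma>. shrink_inv \<sigma> \<and> nat_of \<sigma> ''z'' < j)"
        proof (rule hoare_Seq[OF hoare_scan_shrink[OF S]], unfold Bex_def, rule hoare_ex)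
          fix x
          show "hoare (\<lambda>\<sigma>. x \<in> S \<and> (\<forall>v\<in>S. score S v \<le> score S x) \<and>
              steady a b c \<sigma> \<and> selected S \<sigma> \<and> nat_of \<sigma> ''u'' = x) toggle 5
            (\<lambda>\<sigma>. shrink_inv \<sigma> \<and> nat_of \<sigma> ''z'' < j)"
          proof (cases "x \<in> S \<and> (\<forall>v\<in>S. score S v \<le> score S x)")
            case x: True
            have g: "shrunk k b (S - {x})"
              using x True sizes_facts by (intro shrunk_remove) auto
            have fl: "flip x S = S - {x}" using x by (auto simp: flip_def)
            have cd: "card (S - {x}) < card S"
              using x finite_sub_X[OF S(1)] by (intro psubset_card_mono) auto
            have "hoare (\<lambda>\<sigma>. steady a b c \<sigma> \<and> selected S \<sigma> \<and> nat_of \<sigma> ''u'' = x) toggle 5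
              (\<lambda>\<sigma>. steady a b c \<sigma> \<and> selected (S - {x}) \<sigma>)"
              using hoare_toggle[of x a b c S] x S unfolding fl by blast
            then show ?thesis
            proof (rule hoare_conseq)
              fix \<sigma> assume \<sigma>: "steady a b c \<sigma> \<and> selected (S - {x}) \<sigma>"
              then have "shrink_inv \<sigma>" unfolding shrink_inv_def using g by blast
              moreover have "nat_of \<sigma> ''z'' < j"
                using z_le[of "S - {x}" \<sigma>] \<sigma> cd True by linarith
              ultimately show "shrink_inv \<sigma> \<and> nat_of \<sigma> ''z'' < j" by simp
            qed auto
          next
            case False
            then show ?thesis unfolding hoare_def by blast
          qed
        qed
        then show ?thesis by (rule hoare_conseq) auto
      next
        case False
        then show ?thesis unfolding hoare_def by blast
      qed
    qed
    then show "hoare (\<lambda>\<sigma>. shrink_inv \<sigma> \<and> bval ?b \<sigma> \<and> nat_of \<sigma> ''z'' = j)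
      (Seq (scan shrink_key) toggle) (n * 5 + 3 + 5) (\<lambda>\<sigma>. shrink_inv \<sigma> \<and> nat_of \<sigma> ''z'' < j)"
      by (rule hoare_conseq) (use b z_le in \<open>auto simp only: shrink_inv_def\<close>)
  qed
  then show ?thesis
  proof (rule hoare_conseq)
    fix \<sigma> assume "shrink_inv \<sigma>"
    then show "shrink_inv \<sigma> \<and> nat_of \<sigma> ''z'' \<le> n" using z_le unfolding shrink_inv_def by fastforce
  next
    fix \<sigma> assume "shrink_inv \<sigma> \<and> \<not> bval ?b \<sigma>"
    then obtain S where S: "steady a b c \<sigma>" "selected S \<sigma>" "shrunk k b S" "card S \<le> k"
      using b unfolding shrink_inv_def by (meson not_le)
    then have "card S = k" by (auto simp: shrunk_def)
    then show "\<exists>S. steady a b c \<sigma> \<and> selected S \<sigma> \<and> card S = k \<and> card (nbs S) \<le> b"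
      using S shrunk_final[of k b S] sizes_facts by blast
  qed (auto simp: algebra_simps)
qed

end

section \<open>Writing out the assignment\<close>

definition placed :: "nat set \<Rightarrow> nat \<Rightarrow> nat" where
  "placed S v = (if v \<in> X then if v \<in> S then 3 else 1 else if v \<in> nbs S then 2 else 0)"

definition place_inv :: "nat \<Rightarrow> nat set \<Rightarrow> nat \<Rightarrow> state \<Rightarrow> bool" where
  "place_inv b S i \<sigma> \<longleftrightarrow> nat_of \<sigma> ''n'' = n \<and> nat_of \<sigma> ''x2'' = b \<and> sides_known \<sigma> \<and>
     selected S \<sigma> \<and> (\<forall>v. arr_of \<sigma> ''machine'' v = (if v < i then placed S v else 0)) \<and>
     nat_of \<sigma> ''q'' = card (nbs S \<inter> {..<i})"

lemma cnt_pos_iff: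
  assumes "selected S \<sigma>" "w < n"
  shows "0 < arr_of \<sigma> ''cnt'' w \<longleftrightarrow> w \<in> nbs S"
proof -
  have S: "S \<subseteq> X" using assms by (simp add: selected_def)
  have "0 < arr_of \<sigma> ''cnt'' w \<longleftrightarrow> nb w \<inter> S \<noteq> {}"
    using assms finite_sub_X[OF S] by (simp add: selected_def card_gt_0_iff)
  also have "\<dots> \<longleftrightarrow> w \<in> nbs S"
    using nb_sym_iff[OF assms(2)] S X_less by (auto simp: nbs_def)
  finally show ?thesis .
qed

lemma hoare_place_body:
  assumes i: "i < n"
  shows "hoare (\<lambda>\<sigma>. place_inv b S i \<sigma> \<and> nat_of \<sigma> ''v'' = i) place_body 4 (place_inv b S (Suc i))"
proof (rule hoare_run)
  fix \<sigma> assume \<sigma>: "place_inv b S i \<sigma> \<and> nat_of \<sigma> ''v'' = i"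
  then have S: "S \<subseteq> X" and sel: "selected S \<sigma>" by (auto simp: place_inv_def selected_def)
  have side: "arr_of \<sigma> ''side'' i = side i" and seli: "arr_of \<sigma> ''sel'' i = of_bool (i \<in> S)"
    and v: "nat_of \<sigma> ''v'' = i"
    using \<sigma> i by (auto simp: place_inv_def sides_known_def selected_def)
  note cnt = cnt_pos_iff[OF sel i]
  let ?\<tau> = "run place_body \<sigma>"
  have N: "nbs S \<inter> {..<Suc i} = (if i \<in> nbs S then insert i (nbs S \<inter> {..<i}) else nbs S \<inter> {..<i})"
    by (auto simp: less_Suc_eq)
  have X: "i \<notin> nbs S" if "i \<in> X" using that nbs_subset_Y[OF S] disjoint by blast
  have "selected S ?\<tau>" "sides_known ?\<tau>" "nat_of ?\<tau> ''n'' = n" "nat_of ?\<tau> ''x2'' = b"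
    using \<sigma> by (auto simp: place_body_def place_inv_def selected_def sides_known_def)
  moreover have "arr_of ?\<tau> ''machine'' = (arr_of \<sigma> ''machine'')(i := placed S i)"
    using \<sigma> side seli v cnt S
    by (auto simp: place_body_def place_inv_def placed_def side_def)
  moreover have "nat_of ?\<tau> ''q'' = card (nbs S \<inter> {..<Suc i})"
    using \<sigma> side v cnt X N by (auto simp: place_body_def place_inv_def side_def)
  ultimately show "place_inv b S (Suc i) ?\<tau>"
    using \<sigma> by (auto simp: place_inv_def less_Suc_eq)
qed (simp_all add: place_body_def)

text \<open>\<open>T\<close> and \<open>U\<close> are the vertices of \<open>Y\<close> placed on
  machines 2 and 3 so far; \<open>T\<close> may contain vertices beyond \<open>i\<close>, since it
  includes \<open>nbs S\<close> from the start. The last conjunct says that machine 3 is used only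
  once machine 2 is full.\<close>

definition fill_inv :: "nat \<Rightarrow> nat set \<Rightarrow> nat \<Rightarrow> state \<Rightarrow> bool" where
  "fill_inv b S i \<sigma> \<longleftrightarrow> nat_of \<sigma> ''n'' = n \<and> nat_of \<sigma> ''x2'' = b \<and>
     (\<exists>T U. nbs S \<subseteq> T \<and> T \<union> U \<subseteq> Y \<and> T \<inter> U = {} \<and> Y \<inter> {..<i} \<subseteq> T \<union> U \<and>
       (\<forall>v<n. arr_of \<sigma> ''machine'' v =
         (if v \<in> T then 2 else if v \<in> U then 3 else if v \<in> Y then 0 else placed S v)) \<and>
       nat_of \<sigma> ''q'' = card T \<and> card T \<le> b \<and> (card T < b \<longrightarrow> U = {}))"

lemma fill_invI:
  assumes "nat_of \<sigma> ''n'' = n" "nat_of \<sigma> ''x2'' = b"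
    and "nbs S \<subseteq> T" "T \<union> U \<subseteq> Y" "T \<inter> U = {}" "Y \<inter> {..<i} \<subseteq> T \<union> U"
    and "\<And>v. v < n \<Longrightarrow> arr_of \<sigma> ''machine'' v =
         (if v \<in> T then 2 else if v \<in> U then 3 else if v \<in> Y then 0 else placed S v)"
    and "nat_of \<sigma> ''q'' = card T" "card T \<le> b" "card T < b \<Longrightarrow> U = {}"
  shows "fill_inv b S i \<sigma>"
  unfolding fill_inv_def using assms by blast

lemma hoare_fill_body:
  assumes i: "i < n"
  shows "hoare (\<lambda>\<sigma>. fill_inv b S i \<sigma> \<and> nat_of \<sigma> ''v'' = i) fill_body 4 (fill_inv b S (Suc i))"
proof (rule hoare_run)
  fix \<sigma> assume \<sigma>: "fill_inv b S i \<sigma> \<and> nat_of \<sigma> ''v'' = i"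
  then obtain T U where TU: "nbs S \<subseteq> T" "T \<union> U \<subseteq> Y" "T \<inter> U = {}" "Y \<inter> {..<i} \<subseteq> T \<union> U"
    and mach: "\<And>v. v < n \<Longrightarrow> arr_of \<sigma> ''machine'' v =
         (if v \<in> T then 2 else if v \<in> U then 3 else if v \<in> Y then 0 else placed S v)"
    and q: "nat_of \<sigma> ''q'' = card T" "card T \<le> b" "card T < b \<longrightarrow> U = {}"
    and n: "nat_of \<sigma> ''n'' = n" "nat_of \<sigma> ''x2'' = b" and v: "nat_of \<sigma> ''v'' = i"
    unfolding fill_inv_def by blast
  have fin: "finite T" using TU(2) finite_subset[OF _ finite_Y] by blast
  have zero: "arr_of \<sigma> ''machine'' i = 0 \<longleftrightarrow> i \<in> Y \<and> i \<notin> T \<and> i \<notin> U"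
    using mach[OF i] i verts by (auto simp: placed_def)
  have sub: "Y \<inter> {..<Suc i} \<subseteq> T' \<union> U'" if "T \<subseteq> T'" "U \<subseteq> U'" "i \<in> Y \<Longrightarrow> i \<in> T' \<union> U'" for T' U'
    using TU(4) that unfolding lessThan_Suc by blast
  show "fill_inv b S (Suc i) (run fill_body \<sigma>)"
  proof (cases "arr_of \<sigma> ''machine'' i = 0")
    case False
    have "i \<in> Y \<Longrightarrow> i \<in> T \<union> U" using False zero by auto
    then have "Y \<inter> {..<Suc i} \<subseteq> T \<union> U" by (intro sub subset_refl)
    then have "fill_inv b S (Suc i) \<sigma>"
      using n TU(1-3) mach q by (intro fill_invI[of _ _ S T U]) blast+
    moreover have "run fill_body \<sigma> = \<sigma>" using False v by (simp add: fill_body_def)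
    ultimately show ?thesis by simp
  next
    case True
    then have iY: "i \<in> Y" "i \<notin> T" "i \<notin> U" using zero by auto
    show ?thesis
    proof (cases "card T < b")
      case less: True
      let ?\<tau> = "\<sigma>\<lparr>arr_of := (arr_of \<sigma>)(''machine'' := (arr_of \<sigma> ''machine'')(i := 2)),
          nat_of := (nat_of \<sigma>)(''q'' := Suc (card T))\<rparr>"
      have "fill_inv b S (Suc i) ?\<tau>"
      proof (rule fill_invI)
        show "nbs S \<subseteq> insert i T" using TU(1) by blast
        show "insert i T \<union> U \<subseteq> Y" using TU(2) iY by blast
        show "insert i T \<inter> U = {}" using TU(3) iY by blast
        show "Y \<inter> {..<Suc i} \<subseteq> insert i T \<union> U" by (rule sub) blast+
        show "card (insert i T) < b \<Longrightarrow> U = {}" using less q by blast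
      qed (use n mach less fin iY in simp_all)
      moreover have "run fill_body \<sigma> = ?\<tau>" using True less v q n by (simp add: fill_body_def)
      ultimately show ?thesis by simp
    next
      case False
      let ?\<tau> = "\<sigma>\<lparr>arr_of := (arr_of \<sigma>)(''machine'' := (arr_of \<sigma> ''machine'')(i := 3))\<rparr>"
      have "fill_inv b S (Suc i) ?\<tau>"
      proof (rule fill_invI)
        show "T \<union> insert i U \<subseteq> Y" using TU(2) iY by blast
        show "T \<inter> insert i U = {}" using TU(3) iY by blast
        show "Y \<inter> {..<Suc i} \<subseteq> T \<union> insert i U" by (rule sub) blast+
      qed (use n mach q TU(1) False iY in simp_all)
      moreover have "run fill_body \<sigma> = ?\<tau>" using True False v q n by (simp add: fill_body_def)
      ultimately show ?thesis by simp
    qed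
  qed
qed (simp_all add: fill_body_def)

definition solved :: "nat \<Rightarrow> nat \<Rightarrow> nat \<Rightarrow> state \<Rightarrow> bool" where
  "solved a b c \<sigma> \<longleftrightarrow> (\<exists>S T. S \<subseteq> X \<and> T \<subseteq> Y \<and> nbs S \<subseteq> T \<and> card S = m - a \<and> card T = b \<and>
     output_loads n \<sigma> 1 = X - S \<and> output_loads n \<sigma> 2 = T \<and> output_loads n \<sigma> 3 = S \<union> (Y - T))"

lemma fill_inv_solved:
  assumes "fill_inv b S n \<sigma>" "S \<subseteq> X" "card S = m - a" "b \<le> m"
  shows "solved a b c \<sigma>"
proof -
  obtain T U where TU: "nbs S \<subseteq> T" "T \<union> U \<subseteq> Y" "T \<inter> U = {}" "Y \<inter> {..<n} \<subseteq> T \<union> U"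
    and mach: "\<And>v. v < n \<Longrightarrow> arr_of \<sigma> ''machine'' v =
         (if v \<in> T then 2 else if v \<in> U then 3 else if v \<in> Y then 0 else placed S v)"
    and q: "card T \<le> b" "card T < b \<longrightarrow> U = {}"
    using assms(1) unfolding fill_inv_def by blast
  have U: "U = Y - T" using TU Y_less by auto
  \<comment> \<open>If machine 2 were not full, nothing in \<open>Y\<close> would have gone to
    machine 3, so \<open>T = Y\<close> would have \<open>m \<ge> b\<close> vertices.\<close>
  have "card T = b"
  proof (rule ccontr)
    assume "card T \<noteq> b"
    then have "card T < b" "T = Y" using q U TU(2) by auto
    then show False using card_Y assms(4) by simp
  qed
  have out: "output_loads n \<sigma> i = {v\<in>X. placed S v = i} \<union> (if i = 2 then T else if i = 3 then Y - T else {})"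
    if "i \<in> {1, 2, 3}" for i
  proof -
    have "v \<in> X \<Longrightarrow> v \<notin> Y" for v using disjoint by blast
    moreover have "v < n \<longleftrightarrow> v \<in> X \<or> v \<in> Y" for v using verts by auto
    ultimately show ?thesis
      using that TU(2) unfolding output_loads_def by (auto simp: mach U split: if_splits)
  qed
  have "output_loads n \<sigma> 1 = X - S" "output_loads n \<sigma> 2 = T" "output_loads n \<sigma> 3 = S \<union> (Y - T)"
    using out[of 1] out[of 2] out[of 3] assms(2) by (auto simp: placed_def)
  then show ?thesis
    unfolding solved_def using assms(2,3) TU(1,2) \<open>card T = b\<close> by blast
qed

lemma hoare_output:
  assumes "good_sizes n a b c"
  shows "hoare (\<lambda>\<sigma>. \<exists>S. steady a b c \<sigma> \<and> selected S \<sigma> \<and> card S = m - a \<and> card (nbs S) \<le> b)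
    (Seq (For ''v'' place_body) (For ''v'' fill_body)) (n * 12 + 4) (solved a b c)"
proof (rule hoare_ex)
  fix S
  show "hoare (\<lambda>\<sigma>. steady a b c \<sigma> \<and> selected S \<sigma> \<and> card S = m - a \<and> card (nbs S) \<le> b)
    (Seq (For ''v'' place_body) (For ''v'' fill_body)) (n * 12 + 4) (solved a b c)"
  proof (cases "S \<subseteq> X \<and> card S = m - a \<and> card (nbs S) \<le> b")
    case True
    then have S: "S \<subseteq> X" "card S = m - a" "card (nbs S) \<le> b" by auto
    have b: "b \<le> m" using sizes_facts(3)[OF assms refl] .
    have "hoare (place_inv b S 0) (For ''v'' place_body) (n * (4 + 2) + 2) (place_inv b S n)"
      by (rule hoare_For[OF _ _ _ _ hoare_place_body])
        (auto simp: place_inv_def selected_def sides_known_def place_body_def)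
    moreover have "hoare (place_inv b S n) (For ''v'' fill_body) (n * (4 + 2) + 2) (fill_inv b S n)"
    proof (rule hoare_conseq[OF hoare_For])
      fix \<sigma> assume \<sigma>: "place_inv b S n \<sigma>"
      have "nbs S \<inter> {..<n} = nbs S" using nbs_subset_Y[OF S(1)] Y_less by auto
      then have "nat_of \<sigma> ''q'' = card (nbs S)" using \<sigma> by (simp add: place_inv_def)
      moreover have "arr_of \<sigma> ''machine'' v =
        (if v \<in> nbs S then 2 else if v \<in> {} then 3 else if v \<in> Y then 0 else placed S v)"
        if "v < n" for v
        using \<sigma> that nbs_subset_Y[OF S(1)] disjoint by (auto simp: place_inv_def placed_def)
      ultimately show "fill_inv b S 0 \<sigma>"
        unfolding fill_inv_def using \<sigma> S nbs_subset_Y[OF S(1)]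
        by (intro conjI exI[of _ "nbs S"] exI[of _ "{}"]) (auto simp: place_inv_def)
    next
      fix k assume "k < n"
      then show "hoare (\<lambda>\<sigma>. fill_inv b S k \<sigma> \<and> nat_of \<sigma> ''v'' = k) fill_body 4 (fill_inv b S (Suc k))"
        by (rule hoare_fill_body)
    qed (simp_all add: fill_inv_def fill_body_def)
    ultimately have "hoare (place_inv b S 0) (Seq (For ''v'' place_body) (For ''v'' fill_body))
        ((n * (4 + 2) + 2) + (n * (4 + 2) + 2)) (fill_inv b S n)"
      by (rule hoare_Seq)
    then show ?thesis
    proof (rule hoare_conseq)
      fix \<sigma> assume "fill_inv b S n \<sigma>"
      then show "solved a b c \<sigma>" using fill_inv_solved S b by blast
    qed (auto simp: place_inv_def steady_def sized_def)
  next
    case False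
    then show ?thesis unfolding hoare_def selected_def by blast
  qed
qed

text \<open>The bounds of the phases add up to \<open>16 * n^2 + 41 * n + 36\<close>, which the
  generous constant 100 absorbs.\<close>

lemma hoare_program:
  "hoare (\<lambda>\<sigma>. initial \<sigma> \<and> untouched_sizes \<sigma> \<and> arr_of \<sigma> ''side'' = (\<lambda>_. 0))
     program (100 * (n + 1) ^ 2) (\<lambda>\<sigma>. \<exists>a b c. good_sizes n a b c \<and> solved a b c \<sigma>)"
proof -
  let ?rest = "Seq seed (Seq grow (Seq shrink (Seq (For ''v'' place_body) (For ''v'' fill_body))))"
  let ?t = "19 + ((n * (n * 5 + 9) + 1) + ((n * (n * 5 + 9) + 1) + (n * 12 + 4)))"
  have "hoare (\<lambda>\<sigma>. good_sizes n a b c \<and> initial \<sigma> \<and> sides_known \<sigma> \<and> sized a b c \<sigma>)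
      ?rest ?t (\<lambda>\<sigma>. \<exists>a b c. good_sizes n a b c \<and> solved a b c \<sigma>)" for a b c
  proof (cases "good_sizes n a b c")
    case True
    have "hoare (\<lambda>\<sigma>. steady a b c \<sigma> \<and> (\<exists>y\<in>Y. selected (nb y) \<sigma>)) grow (n * (n * 5 + 9) + 1)
        (shrink_inv a b c (m - a))"
    proof (rule hoare_conseq[OF hoare_grow[OF True refl]])
      fix \<sigma> assume "steady a b c \<sigma> \<and> (\<exists>y\<in>Y. selected (nb y) \<sigma>)"
      then obtain y where y: "steady a b c \<sigma>" "y \<in> Y" "selected (nb y) \<sigma>" by blast
      moreover have "card (nb y) \<le> max 3 (m - a + 1)" using card_nb Y_less y(2) by simp
      ultimately show "grow_inv a b c (m - a) \<sigma>"
        using grown_nb[OF y(2), of "m - a"] unfolding grow_inv_def[OF True refl] by blast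
    qed simp_all
    then have "hoare (\<lambda>\<sigma>. initial \<sigma> \<and> sides_known \<sigma> \<and> sized a b c \<sigma>) ?rest ?t (solved a b c)"
      by (rule hoare_Seq[OF hoare_seed hoare_Seq[OF _ hoare_Seq[OF hoare_shrink[OF True refl]
            hoare_output[OF True]]]])
    then show ?thesis using True by (elim hoare_conseq) auto
  next
    case False
    then show ?thesis by (simp add: hoare_def)
  qed
  then have "hoare (\<lambda>\<sigma>. \<exists>a b c. good_sizes n a b c \<and> initial \<sigma> \<and> sides_known \<sigma> \<and> sized a b c \<sigma>)
      ?rest ?t (\<lambda>\<sigma>. \<exists>a b c. good_sizes n a b c \<and> solved a b c \<sigma>)"
    by (intro hoare_ex)
  then have "hoare (\<lambda>\<sigma>. initial \<sigma> \<and> untouched_sizes \<sigma> \<and> arr_of \<sigma> ''side'' = (\<lambda>_. 0))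
     program ((n * (n * 6 + 4) + 3) + ((n * 7 + 8) + ?t))
     (\<lambda>\<sigma>. \<exists>a b c. good_sizes n a b c \<and> solved a b c \<sigma>)"
    unfolding program_def by (intro hoare_Seq[OF hoare_colour] hoare_Seq[OF hoare_sizes])
  then show ?thesis
    by (rule hoare_conseq) (auto simp: algebra_simps power2_eq_square)
qed

lemma solved_loads:
  assumes "good_sizes n a b c" "solved a b c \<sigma>"
  shows "(\<Union>i\<in>machines. output_loads n \<sigma> i) = {0..<n}"
    and "\<And>i j. i \<in> machines \<Longrightarrow> j \<in> machines \<Longrightarrow> i \<noteq> j \<Longrightarrow>
      output_loads n \<sigma> i \<inter> output_loads n \<sigma> j = {}"
    and "\<And>i u v. i \<in> machines \<Longrightarrow> u \<in> output_loads n \<sigma> i \<Longrightarrow> v \<in> output_loads n \<sigma> i \<Longrightarrow> v \<notin> nb u"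
    and "\<And>i. i \<in> machines \<Longrightarrow> card (output_loads n \<sigma> i) = loads a b c i"
proof -
  obtain S T where S: "S \<subseteq> X" and T: "T \<subseteq> Y" and N: "nbs S \<subseteq> T"
    and cS: "card S = m - a" and cT: "card T = b"
    and L: "output_loads n \<sigma> 1 = X - S" "output_loads n \<sigma> 2 = T" "output_loads n \<sigma> 3 = S \<union> (Y - T)"
    using assms(2) unfolding solved_def by blast
  show "(\<Union>i\<in>machines. output_loads n \<sigma> i) = {0..<n}"
    using S T L verts by (auto simp: machines_def)
  show "output_loads n \<sigma> i \<inter> output_loads n \<sigma> j = {}"
    if "i \<in> machines" "j \<in> machines" "i \<noteq> j" for i j
    using that unfolding output_loads_def by auto
  have XX: "v \<notin> nb u" if "u \<in> X" "v \<in> X" for u v using that nb_X[of u] disjoint by blast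
  have YY: "v \<notin> nb u" if "u \<in> Y" "v \<in> Y" for u v using that nb_Y[of u] disjoint by blast
  \<comment> \<open>Only the third load mixes both sides, and \<open>nbs S \<subseteq> T\<close>
    keeps its two parts apart.\<close>
  have SY: "v \<notin> nb u" "u \<notin> nb v" if "u \<in> S" "v \<in> Y - T" for u v
  proof -
    show "v \<notin> nb u" using that N by (auto simp: nbs_def)
    then show "u \<notin> nb v" using nb_sym_iff[of u v] that S X_less Y_less by blast
  qed
  show "v \<notin> nb u" if "i \<in> machines" "u \<in> output_loads n \<sigma> i" "v \<in> output_loads n \<sigma> i" for i u v
  proof -
    have "i = 1 \<or> i = 2 \<or> i = 3" using that(1) by (auto simp: machines_def)
    then show ?thesis
    proof (elim disjE)
      assume "i = 1"
      then have "u \<in> X" "v \<in> X" using that(2,3) L(1) by auto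
      then show ?thesis by (rule XX)
    next
      assume "i = 2"
      then have "u \<in> Y" "v \<in> Y" using that(2,3) L(2) T by auto
      then show ?thesis by (rule YY)
    next
      assume "i = 3"
      then have "u \<in> S \<or> u \<in> Y - T" "v \<in> S \<or> v \<in> Y - T" using that(2,3) L(3) by auto
      then show ?thesis using SY[of u v] SY[of v u] XX[of u v] YY[of u v] S by blast
    qed
  qed
  show "card (output_loads n \<sigma> i) = loads a b c i" if "i \<in> machines" for i
  proof -
    note f = sizes_facts[OF assms(1) refl]
    have "card (X - S) = a" using S cS f finite_sub_X by (simp add: card_Diff_subset)
    moreover have "card (S \<union> (Y - T)) = c"
    proof -
      have "card (S \<union> (Y - T)) = card S + card (Y - T)"
        using S disjoint finite_sub_X by (intro card_Un_disjoint) auto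
      also have "card (Y - T) = m - b"
        using T cT card_Y finite_subset[OF T finite_Y] by (simp add: card_Diff_subset)
      finally show ?thesis using cS f by linarith
    qed
    moreover have "i = 1 \<or> i = 2 \<or> i = 3" using that by (auto simp: machines_def)
    ultimately show ?thesis using L cT by auto
  qed
qed

text \<open>The loads of any competing schedule are independent sets that partition the vertices, so
  their sizes satisfy the cap and the total in \<open>optimal_sizes\<close>.\<close>

lemma optimal_schedule_if_solved:
  fixes G :: "nat pair_pre_digraph"
  assumes G: "pverts G = {0..<n}"
    and nb: "\<And>u v. u < n \<Longrightarrow> v \<in> nb u \<longleftrightarrow> (u, v) \<in> parcs G"
    and good: "good_sizes n a b c" and solved: "solved a b c \<sigma>"
  shows "optimal_schedule (with_proj G) s (output_loads n \<sigma>)"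
proof -
  note sol = solved_loads[OF good solved]
  have less: "v < n" if "i \<in> machines" "v \<in> output_loads n \<sigma> i" for v i
    using that(2) by (simp add: output_loads_def)
  have "schedule (with_proj G) (output_loads n \<sigma>)"
    unfolding schedule_def independent_set_def
  proof (intro conjI ballI impI)
    show "(\<Union>i\<in>machines. output_loads n \<sigma> i) = verts (with_proj G)" using sol(1) G by simp
  next
    fix i j :: nat assume "i \<in> machines" "j \<in> machines" "i \<noteq> j"
    then show "output_loads n \<sigma> i \<inter> output_loads n \<sigma> j = {}" by (rule sol(2))
  next
    fix i assume "i \<in> machines"
    then show "output_loads n \<sigma> i \<subseteq> verts (with_proj G)" using less G by auto
  next
    fix i u v assume "i \<in> machines" "u \<in> output_loads n \<sigma> i" "v \<in> output_loads n \<sigma> i"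
    then have "v \<notin> nb u" "u < n" using sol(3) less by blast+
    then show "\<not> u \<rightarrow>\<^bsub>with_proj G\<^esub> v" using nb by simp
  qed
  moreover have "Cmax s (output_loads n \<sigma>) \<le> Cmax s J" if J: "schedule (with_proj G) J" for J
  proof (rule optimal_sizes_Cmax_le)
    show "optimal_sizes n (loads a b c)" using good by (simp add: good_sizes_def)
    show "\<And>i. i \<in> machines \<Longrightarrow> card (output_loads n \<sigma> i) = loads a b c i" by (rule sol(4))
    have ind: "J i \<subseteq> {0..<n}" "\<And>u v. u \<in> J i \<Longrightarrow> v \<in> J i \<Longrightarrow> v \<notin> nb u" if "i \<in> machines" for i
    proof -
      have "independent_set (with_proj G) (J i)" using J that by (simp add: schedule_def)
      then have sub: "J i \<subseteq> {0..<n}" and "\<forall>u\<in>J i. \<forall>v\<in>J i. (u, v) \<notin> parcs G"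
        using G by (simp_all add: independent_set_def)
      then show "v \<notin> nb u" if "u \<in> J i" "v \<in> J i" for u v
        using that nb[of u v] by auto
      show "J i \<subseteq> {0..<n}" by fact
    qed
    show "2 * card (J i) \<le> n" if "i \<in> machines" for i
      using card_independent_le[OF ind[OF that]] n_eq by linarith
    have fin: "finite (J i)" if "i \<in> machines" for i
      using finite_subset[OF ind(1)[OF that]] by simp
    have "J 1 \<union> J 2 \<union> J 3 = {0..<n}" "J 1 \<inter> J 2 = {}" "(J 1 \<union> J 2) \<inter> J 3 = {}"
    proof -
      have "(\<Union>i\<in>machines. J i) = {0..<n}"
        and "\<And>i j. i \<in> machines \<Longrightarrow> j \<in> machines \<Longrightarrow> i \<noteq> j \<Longrightarrow> J i \<inter> J j = {}"
        using J G by (auto simp: schedule_def)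
      from this(1) this(2)[of 1 2] this(2)[of 1 3] this(2)[of 2 3]
      show "J 1 \<union> J 2 \<union> J 3 = {0..<n}" "J 1 \<inter> J 2 = {}" "(J 1 \<union> J 2) \<inter> J 3 = {}"
        by (auto simp: machines_def)
    qed
    moreover have "finite (J 1)" "finite (J 2)" "finite (J 3)"
      using fin by (auto simp: machines_def)
    ultimately show "card (J 1) + card (J 2) + card (J 3) = n"
      using card_Un_disjoint[of "J 1" "J 2"] card_Un_disjoint[of "J 1 \<union> J 2" "J 3"] by simp
  qed
  ultimately show ?thesis by (simp add: optimal_schedule_def)
qed

end

section \<open>From library digraphs to the locale\<close>

lemma cubic_inputI:
  fixes G :: "nat pair_pre_digraph" and N :: "nat \<Rightarrow> nat list" and s :: "nat \<Rightarrow> real"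
  assumes G: "graph (with_proj G)" "verts (with_proj G) = {0..<n}"
    and conn: "Digraph_Component.connected (with_proj G)" and bip: "bipartite (with_proj G)"
    and cub: "cubic (with_proj G)" and K33: "\<not> complete_bipartite_digraph 3 3 (with_proj G)"
    and N: "adjacency_lists (with_proj G) N"
    and s: "s 1 \<ge> s 2" "s 2 \<ge> s 3" "s 3 > 0"
  obtains X Y where
    "cubic_input n (\<lambda>v. {w. (v, w) \<in> parcs G}) X Y s (\<lambda>k. if k < 3 * n then N (k div 3) ! (k mod 3) else 0)"
proof -
  interpret G: graph "with_proj G" by fact
  have V: "pverts G = {0..<n}" using G(2) by simp
  have sym: "(u, v) \<in> parcs G \<Longrightarrow> (v, u) \<in> parcs G" for u v
    using G.sym_arcs by (auto simp: symmetric_def elim: symE)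
  have less: "u < n" "v < n" if "(u, v) \<in> parcs G" for u v
    using G.tail_in_verts[of "(u, v)"] G.head_in_verts[of "(u, v)"] that V by auto
  let ?nb = "\<lambda>v. {w. (v, w) \<in> parcs G}"
  have n_pos: "0 < n" using conn V by (auto simp: connected_conv)
  obtain U W where UW: "U \<union> W = {0..<n}" "U \<inter> W = {}"
    "independent_set (with_proj G) U" "independent_set (with_proj G) W"
    using bip V unfolding bipartite_def by auto
  \<comment> \<open>\<open>X\<close> is named after vertex 0, from which the colouring
    starts.\<close>
  define X where "X = (if 0 \<in> U then U else W)"
  define Y where "Y = (if 0 \<in> U then W else U)"
  have XY: "X \<union> Y = {0..<n}" "X \<inter> Y = {}" "0 \<in> X"
    and ind: "independent_set (with_proj G) X" "independent_set (with_proj G) Y"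
    using UW n_pos unfolding X_def Y_def by auto
  have card3: "card (?nb v) = 3" if "v < n" for v
  proof -
    have "out_arcs (with_proj G) v = Pair v ` ?nb v" by (auto simp: out_arcs_def)
    then have "out_degree (with_proj G) v = card (?nb v)"
      by (simp add: out_degree_def card_image inj_on_def)
    then show ?thesis using cub that V by (simp add: cubic_def)
  qed
  \<comment> \<open>Directed paths are needed because closedness under \<open>?nb\<close> spreads
    along arcs.\<close>
  have sc: "strongly_connected (with_proj G)"
    using G.symmetric_connected_imp_strongly_connected[OF G.sym_arcs conn] .
  have indep: "(u, v) \<notin> parcs G" if "u \<in> X \<and> v \<in> X \<or> u \<in> Y \<and> v \<in> Y" for u v
    using ind that by (auto simp: independent_set_def)
  have in_XY: "v \<in> X \<or> v \<in> Y" if "(u, v) \<in> parcs G" for u v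
    using XY(1) less(2)[OF that] by (metis Un_iff atLeastLessThan_iff le0)
  interpret bicubic n ?nb X Y
  proof
    show "?nb x \<subseteq> Y" if "x \<in> X" for x
      using that indep in_XY by blast
    show "?nb y \<subseteq> X" if "y \<in> Y" for y
      using that indep in_XY by blast
    show "v < n \<Longrightarrow> card (?nb v) = 3" for v by (rule card3)
    show "u \<in> ?nb v" if "v \<in> ?nb u" for u v using that sym by simp
    show "S = {0..<n}" if S: "S \<subseteq> {0..<n}" "S \<noteq> {}" and closed: "\<And>v. v \<in> S \<Longrightarrow> ?nb v \<subseteq> S" for S
    proof -
      obtain u where u: "u \<in> S" using S by blast
      have "v \<in> S" if "v < n" for v
      proof -
        have "u \<rightarrow>\<^sup>*\<^bsub>with_proj G\<^esub> v"
          using sc u S(1) that V by (auto simp: strongly_connected_def)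
        then have "(u, v) \<in> (parcs G)\<^sup>*" by (auto dest: reachable_rtranclI)
        then show ?thesis by (induction) (use u closed in auto)
      qed
      then show ?thesis using S(1) by auto
    qed
  qed (use XY in simp_all)
  have "card X \<noteq> 3"
  proof
    assume X3: "card X = 3"
    \<comment> \<open>With three vertices on each side and degree 3, all cross pairs are
      arcs.\<close>
    have "parcs G = X \<times> Y \<union> Y \<times> X"
    proof -
      have 1: "(x, y) \<in> parcs G \<longleftrightarrow> y \<in> Y" if "x \<in> X" for x y
        using complete_if_card_X_3[OF X3 that] by blast
      have 2: "(y, x) \<in> parcs G \<longleftrightarrow> x \<in> X" if "y \<in> Y" for x y
        using 1[of x y] sym nb_Y[OF that] that by blast
      have "(u, v) \<in> parcs G \<longleftrightarrow> (u, v) \<in> X \<times> Y \<union> Y \<times> X" for u v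
        using 1 2 in_XY[of v u] sym by blast
      then show ?thesis by (simp add: set_eq_iff split_paired_All)
    qed
    then have "complete_bipartite_digraph 3 3 (with_proj G)"
      unfolding complete_bipartite_digraph_def using G(1) V XY X3 card_Y
      by (intro conjI exI[of _ X] exI[of _ Y]) auto
    then show False using K33 by simp
  qed
  then interpret bicubic_not_K33 n ?nb X Y by unfold_locales
  have "?nb v = {N v ! 0, N v ! 1, N v ! 2}" if v: "v < n" for v
  proof -
    have d: "distinct (N v)" "set (N v) = ?nb v"
      using N v V unfolding adjacency_lists_def by auto
    then have "length (N v) = 3" using card3[OF v] distinct_card[of "N v"] by simp
    then obtain x y z where "N v = [x, y, z]"
      by (auto simp: numeral_3_eq_3 length_Suc_conv)
    then show ?thesis using d(2) by simp
  qed
  moreover have "(v + v + v) div 3 = v" "(v + v + v) mod 3 = 0" "(v + v + Suc v) div 3 = v"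
    "(v + v + Suc v) mod 3 = 1" "(v + v + Suc (Suc v)) div 3 = v" "(v + v + Suc (Suc v)) mod 3 = 2"
    for v :: nat by presburger+
  moreover have "v + v + v < 3 * n" "v + v + Suc v < 3 * n" "v + v + Suc (Suc v) < 3 * n"
    if "v < n" for v using that by linarith+
  ultimately have "cubic_input n ?nb X Y s (\<lambda>k. if k < 3 * n then N (k div 3) ! (k mod 3) else 0)"
    using s by unfold_locales (simp_all only: if_True)
  then show thesis by (rule that)
qed

theorem theorem1:
  shows "\<exists>(P :: com) (T :: nat \<Rightarrow> nat).
    (\<lambda>n. real (T n)) \<in> O(\<lambda>n. real n ^ 2) \<and>
    (\<forall>(n :: nat) (G :: nat pair_pre_digraph) (N :: nat \<Rightarrow> nat list) (s :: nat \<Rightarrow> real).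
       graph (with_proj G) \<and> verts (with_proj G) = {0..<n} \<and>
       Digraph_Component.connected (with_proj G) \<and> bipartite (with_proj G) \<and>
       cubic (with_proj G) \<and> \<not> complete_bipartite_digraph 3 3 (with_proj G) \<and>
       adjacency_lists (with_proj G) N \<and>
       s 1 \<ge> s 2 \<and> s 2 \<ge> s 3 \<and> s 3 > 0 \<longrightarrow>
       (\<exists>t \<sigma>. exec P (input_state n N s) t \<sigma> \<and> t \<le> T n \<and>
          optimal_schedule (with_proj G) s (output_loads n \<sigma>)))"
proof (rule exI[of _ program], rule exI[of _ "\<lambda>n. 100 * (n + 1) ^ 2"], intro conjI allI impI)
  show "(\<lambda>n. real (100 * (n + 1) ^ 2)) \<in> O(\<lambda>n. real n ^ 2)"
  proof (rule bigoI)
    show "\<forall>\<^sub>F n in sequentially. norm (real (100 * (n + 1) ^ 2)) \<le> 400 * norm (real n ^ 2)"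
      using eventually_ge_at_top[of 1]
    proof eventually_elim
      case (elim n)
      \<comment> \<open>Doubling the base costs a factor 4, whence the constant
        \<open>400 = 4 * 100\<close>.\<close>
      then have "(n + 1) ^ 2 \<le> (2 * n) ^ 2" by (intro power_mono) auto
      then have "real ((n + 1) ^ 2) \<le> real ((2 * n) ^ 2)" by (simp only: of_nat_le_iff)
      then show ?case by (simp add: power_mult_distrib)
    qed
  qed
next
  fix n :: nat and G :: "nat pair_pre_digraph" and N :: "nat \<Rightarrow> nat list" and s :: "nat \<Rightarrow> real"
  assume G: "graph (with_proj G) \<and> verts (with_proj G) = {0..<n} \<and>
       Digraph_Component.connected (with_proj G) \<and> bipartite (with_proj G) \<and>
       cubic (with_proj G) \<and> \<not> complete_bipartite_digraph 3 3 (with_proj G) \<and>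
       adjacency_lists (with_proj G) N \<and> s 1 \<ge> s 2 \<and> s 2 \<ge> s 3 \<and> s 3 > 0"
  let ?nb = "\<lambda>v. {w. (v, w) \<in> parcs G}"
  let ?A = "\<lambda>k. if k < 3 * n then N (k div 3) ! (k mod 3) else 0"
  obtain X Y where "cubic_input n ?nb X Y s ?A"
    using cubic_inputI[of G n N s] G by blast
  then interpret cubic_input n ?nb X Y s ?A .
  have "initial (input_state n N s)" "untouched_sizes (input_state n N s)"
    "arr_of (input_state n N s) ''side'' = (\<lambda>_. 0)"
    by (auto simp: initial_def untouched_sizes_def input_state_def)
  then obtain t \<sigma> a b c where "exec program (input_state n N s) t \<sigma>" "t \<le> 100 * (n + 1) ^ 2"
    and sol: "good_sizes n a b c" "solved a b c \<sigma>"
    using hoareD[OF hoare_program, of "input_state n N s"] by blast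
  moreover have "optimal_schedule (with_proj G) s (output_loads n \<sigma>)"
    using sol G by (intro optimal_schedule_if_solved) auto
  ultimately show "\<exists>t \<sigma>. exec program (input_state n N s) t \<sigma> \<and> t \<le> 100 * (n + 1) ^ 2 \<and>
      optimal_schedule (with_proj G) s (output_loads n \<sigma>)" by blast
qed

end
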